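(* Let $k$ be a field, let $\mathcal{H}$ be a simple $d$-uniform hypergraph on the vertex set $V=\{x_1,\dots,x_n\}$, let $R=k[x_1,\dots,x_n]$, and let $I=I(\mathcal{H})\subseteq R$ be its edge ideal. Let $c$ be the minimum size of a 2-collage in $\mathcal{H}$. Then $\operatorname{reg}(R/I)\le (d-1)c$.
   Context: A hypergraph $\mathcal{H}=(V,\mathcal{E})$ consists of a finite vertex set $V$ and a collection $\mathcal{E}$ of nonempty subsets of $V$ (edges); it is simple if there are no containments $E\subsetneq E'$ between edges, and $d$-uniform if every edge has exactly $d$ vertices. The edge ideal is $I(\mathcal{H})=(\prod_{x\in E}x : E\in\mathcal{E})\subseteq R$, the vertices being identified with the variables. A 2-collage for $\mathcal{H}$ is a subset $\mathcal{C}\subseteq\mathcal{E}$ such that for every edge $E\in\mathcal{E}$ there is a vertex $v\in E$ and an edge $F\in\mathcal{C}$ with $E\setminus\{v\}\subseteq F$. $\operatorname{reg}$ denotes Castelnuovo–Mumford regularity: $\operatorname{reg}(M)=\max_i\{\max\{j:\operatorname{Tor}_i^R(M,k)_j\ne0\}-i\}$. *)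

theory Defs
  imports
    "HOL-Library.Poly_Mapping"
    "HOL-Library.Extended_Real"
    "HOL-Algebra.Algebra"
    "HOL-Algebra.Algebraic_Closure_Type"
begin

section \<open>The standard graded polynomial ring\<close>

text \<open>
  The elements of \<open>R = k[x\<^sub>1, \<dots>, x\<^sub>n]\<close> are the finitely supported maps from exponent vectors to
  coefficients; the variables are the elements of a finite type \<open>'v\<close>, and \<open>n = CARD('v)\<close>.
\<close>

type_synonym ('v, 'k) mpoly = "('v \<Rightarrow>\<^sub>0 nat) \<Rightarrow>\<^sub>0 'k"

abbreviation poly_ring :: "('v, 'k::field) mpoly ring" where
  "poly_ring \<equiv> ring_of_type_algebra"

definition var :: "'v \<Rightarrow> ('v, 'k::field) mpoly" where
  "var x = Poly_Mapping.single (Poly_Mapping.single x 1) 1"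

definition total_degree :: "('v \<Rightarrow>\<^sub>0 nat) \<Rightarrow> nat" where
  "total_degree m = (\<Sum>x\<in>Poly_Mapping.keys m. Poly_Mapping.lookup m x)"

text \<open>As usual, the zero polynomial is homogeneous of every degree.\<close>

definition homogeneous :: "int \<Rightarrow> ('v, 'k::field) mpoly \<Rightarrow> bool" where
  "homogeneous j p \<longleftrightarrow> (\<forall>m\<in>Poly_Mapping.keys p. int (total_degree m) = j)"

definition const_coeff :: "('v, 'k::field) mpoly \<Rightarrow> 'k" where
  "const_coeff p = Poly_Mapping.lookup p 0"


section \<open>Graded modules\<close>

record ('r, 'm) graded_module = "('r, 'm) module" +
  grade :: "int \<Rightarrow> 'm set"

text \<open>The graded module \<open>R/I\<close>, for a homogeneous ideal \<open>I\<close> of \<open>R\<close>.\<close>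

definition quotient_module ::
    "('v, 'k::field) mpoly set \<Rightarrow> (('v, 'k) mpoly, ('v, 'k) mpoly set) graded_module" where
  "quotient_module I = \<lparr>
     carrier = carrier (poly_ring Quot I),
     monoid.mult = monoid.mult (poly_ring Quot I),
     monoid.one = monoid.one (poly_ring Quot I),
     ring.zero = ring.zero (poly_ring Quot I),
     ring.add = ring.add (poly_ring Quot I),
     module.smult = (\<lambda>r y. (I +>\<^bsub>poly_ring\<^esub> r) \<otimes>\<^bsub>poly_ring Quot I\<^esub> y),
     grade = (\<lambda>j. {I +>\<^bsub>poly_ring\<^esub> f | f. homogeneous j f}) \<rparr>"


section \<open>Graded free resolutions\<close>

text \<open>
  A complex \<open>\<dots> \<rightarrow> F\<^sub>2 \<rightarrow> F\<^sub>1 \<rightarrow> F\<^sub>0 \<rightarrow> M \<rightarrow> 0\<close> with \<open>F\<^sub>i\<close> free of finite rank is given in coordinates: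
  \<open>F\<^sub>i\<close> has the basis \<open>e\<^sub>i\<^sub>,\<^sub>b\<close> for \<open>b < rank F i\<close>, the basis element \<open>e\<^sub>i\<^sub>,\<^sub>b\<close> has degree
  \<open>basis_deg F i b\<close>, the entry \<open>differential F i a b\<close> is the coefficient of \<open>e\<^sub>i\<^sub>,\<^sub>a\<close> in the image
  of \<open>e\<^sub>i\<^sub>+\<^sub>1\<^sub>,\<^sub>b\<close>, and \<open>augmentation F b\<close> is the image of \<open>e\<^sub>0\<^sub>,\<^sub>b\<close> in \<open>M\<close>.
\<close>

record ('r, 'm) free_complex =
  rank :: "nat \<Rightarrow> nat"
  basis_deg :: "nat \<Rightarrow> nat \<Rightarrow> int"
  differential :: "nat \<Rightarrow> nat \<Rightarrow> nat \<Rightarrow> 'r"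
  augmentation :: "nat \<Rightarrow> 'm"

definition free_module :: "nat \<Rightarrow> (nat \<Rightarrow> 'r::zero) set" where
  "free_module r = {v. \<forall>b\<ge>r. v b = 0}"

definition diff_map :: "('r::comm_ring_1, 'm) free_complex \<Rightarrow> nat \<Rightarrow> (nat \<Rightarrow> 'r) \<Rightarrow> (nat \<Rightarrow> 'r)" where
  "diff_map F i v =
     (\<lambda>a. if a < rank F i then \<Sum>b<rank F (Suc i). differential F i a b * v b else 0)"

definition aug_map ::
    "('r, 'm) graded_module \<Rightarrow> ('r, 'm) free_complex \<Rightarrow> (nat \<Rightarrow> 'r) \<Rightarrow> 'm" where
  "aug_map M F v = (\<Oplus>\<^bsub>M\<^esub>b\<in>{..<rank F 0}. v b \<odot>\<^bsub>M\<^esub> augmentation F b)"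

definition graded_free_resolution ::
    "(('v, 'k::field) mpoly, 'm) graded_module \<Rightarrow> (('v, 'k) mpoly, 'm) free_complex \<Rightarrow> bool" where
  "graded_free_resolution M F \<longleftrightarrow>
     (\<forall>b<rank F 0. augmentation F b \<in> grade M (basis_deg F 0 b)) \<and>
     (\<forall>i. \<forall>a<rank F i. \<forall>b<rank F (Suc i).
        homogeneous (basis_deg F (Suc i) b - basis_deg F i a) (differential F i a b)) \<and>
     aug_map M F ` free_module (rank F 0) = carrier M \<and>
     {v \<in> free_module (rank F 0). aug_map M F v = \<zero>\<^bsub>M\<^esub>} =
       diff_map F 0 ` free_module (rank F 1) \<and>
     (\<forall>i. {v \<in> free_module (rank F (Suc i)). diff_map F i v = (\<lambda>_. 0)} =
       diff_map F (Suc i) ` free_module (rank F (Suc (Suc i))))"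


section \<open>Tor and Castelnuovo--Mumford regularity\<close>

text \<open>
  Here \<open>k = R/(x\<^sub>1, \<dots>, x\<^sub>n)\<close>, so \<open>F\<^sub>i \<otimes>\<^sub>R k\<close> is the \<open>k\<close>-vector space on the basis of \<open>F\<^sub>i\<close>, its
  component of degree \<open>j\<close> is spanned by the basis elements of degree \<open>j\<close>, and the matrix of the
  induced differential consists of the constant coefficients of the entries.
\<close>

definition tensor_k :: "(('v, 'k::field) mpoly, 'm) free_complex \<Rightarrow> nat \<Rightarrow> int \<Rightarrow> (nat \<Rightarrow> 'k) set" where
  "tensor_k F i j = {u. \<forall>b. u b \<noteq> 0 \<longrightarrow> b < rank F i \<and> basis_deg F i b = j}"

definition tensor_k_diff ::
    "(('v, 'k::field) mpoly, 'm) free_complex \<Rightarrow> nat \<Rightarrow> (nat \<Rightarrow> 'k) \<Rightarrow> (nat \<Rightarrow> 'k)" where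
  "tensor_k_diff F i u =
     (\<lambda>a. if a < rank F i
          then \<Sum>b<rank F (Suc i). const_coeff (differential F i a b) * u b else 0)"

definition cycles_k :: "(('v, 'k::field) mpoly, 'm) free_complex \<Rightarrow> nat \<Rightarrow> int \<Rightarrow> (nat \<Rightarrow> 'k) set" where
  "cycles_k F i j =
     (case i of
        0 \<Rightarrow> tensor_k F 0 j
      | Suc i' \<Rightarrow> {u \<in> tensor_k F (Suc i') j. tensor_k_diff F i' u = (\<lambda>_. 0)})"

definition boundaries_k ::
    "(('v, 'k::field) mpoly, 'm) free_complex \<Rightarrow> nat \<Rightarrow> int \<Rightarrow> (nat \<Rightarrow> 'k) set" where
  "boundaries_k F i j = tensor_k_diff F i ` tensor_k F (Suc i) j"

text \<open>The degree \<open>j\<close> component of \<open>H\<^sub>i(F \<otimes>\<^sub>R k)\<close>, as an (additive) quotient group.\<close>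

definition homology_k ::
    "(('v, 'k::field) mpoly, 'm) free_complex \<Rightarrow> nat \<Rightarrow> int \<Rightarrow> (nat \<Rightarrow> 'k) set monoid" where
  "homology_k F i j =
     \<lparr>carrier = cycles_k F i j, monoid.mult = (\<lambda>u v a. u a + v a), one = (\<lambda>_. 0)\<rparr>
       Mod boundaries_k F i j"

text \<open>
  \<open>Tor\<^sub>i\<^sup>R(M, k)\<^sub>j\<close> for a finitely generated graded \<open>R\<close>-module \<open>M\<close>.  Such a module has graded free
  resolutions by modules of finite rank because \<open>R\<close> is Noetherian, and up to isomorphism the
  homology does not depend on the one that is chosen.
\<close>

definition Tor_k :: "(('v, 'k::field) mpoly, 'm) graded_module \<Rightarrow> nat \<Rightarrow> int \<Rightarrow> (nat \<Rightarrow> 'k) set monoid" where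
  "Tor_k M i j = homology_k (SOME F. graded_free_resolution M F) i j"

text \<open>
  The maxima are taken in the extended reals, as suprema: \<open>i\<close> with \<open>Tor\<^sub>i\<^sup>R(M, k) = 0\<close>
  contribute \<open>-\<infinity>\<close>, so that the zero module has regularity \<open>-\<infinity>\<close>.
\<close>

definition reg :: "(('v, 'k::field) mpoly, 'm) graded_module \<Rightarrow> ereal" where
  "reg M = (SUP i. (SUP j\<in>{j. carrier (Tor_k M i j) \<noteq> {\<one>\<^bsub>Tor_k M i j\<^esub>}}. ereal (real_of_int j))
                     - ereal (real i))"


section \<open>Hypergraphs\<close>

text \<open>
  A hypergraph is given by its set of edges; its vertex set is the finite type \<open>'v\<close> of the
  variables of \<open>R\<close>.
\<close>

definition hypergraph :: "'v::finite set set \<Rightarrow> bool" where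
  "hypergraph \<E> \<longleftrightarrow> {} \<notin> \<E>"

definition simple_hypergraph :: "'v::finite set set \<Rightarrow> bool" where
  "simple_hypergraph \<E> \<longleftrightarrow> hypergraph \<E> \<and> (\<forall>E\<in>\<E>. \<forall>E'\<in>\<E>. \<not> E \<subset> E')"

definition uniform :: "nat \<Rightarrow> 'v::finite set set \<Rightarrow> bool" where
  "uniform d \<E> \<longleftrightarrow> (\<forall>E\<in>\<E>. card E = d)"

definition edge_ideal :: "'v::finite set set \<Rightarrow> ('v, 'k::field) mpoly set" where
  "edge_ideal \<E> = Idl\<^bsub>poly_ring\<^esub> {\<Prod>x\<in>E. var x | E. E \<in> \<E>}"

definition two_collage :: "'v::finite set set \<Rightarrow> 'v set set \<Rightarrow> bool" where
  "two_collage \<E> \<C> \<longleftrightarrow> \<C> \<subseteq> \<E> \<and> (\<forall>E\<in>\<E>. \<exists>v\<in>E. \<exists>F\<in>\<C>. E - {v} \<subseteq> F)"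

definition min_two_collage_size :: "'v::finite set set \<Rightarrow> nat" where
  "min_two_collage_size \<E> = Min {card \<C> | \<C>. two_collage \<E> \<C>}"

end

theory Submission
  imports Defs
begin

text \<open>
  Choose a minimum 2-collage and assign to every edge \<open>E\<close> an edge \<open>\<phi> E\<close> of the collage from which it
  differs in at most one vertex, with \<open>\<phi> F = F\<close> on the collage. Let \<open>\<Delta>\<close> be the simplicial complex on
  the edges whose faces are the sets \<open>A\<close> such that any two edges of \<open>A\<close> with the same \<open>\<phi> E \<noteq> E\<close> miss
  the same vertex of \<open>\<phi> E\<close>. For every vertex set \<open>S\<close> that contains an edge, the subcomplex of the
  faces with \<open>\<Union>A \<subseteq> S\<close> is a cone, so the restriction of the Taylor complex to \<open>\<Delta>\<close> is a free
  resolution of \<open>R/I\<close>, exactness being checked in each multidegree. A face \<open>A\<close> contributes to it a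
  basis element of degree \<open>card (\<Union>A) \<le> card A + (d - 1) c\<close> in homological degree \<open>card A\<close>. Comparing
  this resolution with an arbitrary one bounds the regularity.
\<close>

section \<open>Homogeneous components\<close>

text \<open>The resolution picked inside \<open>Tor_k\<close> is arbitrary and need not be minimal,
  so its own basis degrees say nothing; what can be shown is that its homology over \<open>k\<close>
  vanishes wherever a known resolution has no basis element. The full simplex on the edges would
  give the Taylor resolution, but its bound is too weak: edges sharing \<open>F = \<phi> E\<close>
  each add at most one vertex to \<open>F\<close>, so m of them, without \<open>F\<close> itself,
  may cover m + d vertices, one too many. If they all miss the same vertex of \<open>F\<close>, they
  cover at most m + d - 1; if \<open>F\<close> is among them, it counts as one of the m edges. This
  is the origin of the condition on \<open>\<Delta>\<close> and of the factor \<open>d - 1\<close>,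
  paid once per collage edge. The condition does not destroy the cones: if \<open>\<phi> E\<close>
  lies in \<open>S\<close>, it is an apex, being exempt from the condition; if not, a vertex of
  \<open>\<phi> E\<close> outside \<open>S\<close> is missed by all edges in \<open>S\<close>
  assigned to \<open>\<phi> E\<close>, so \<open>E\<close> is compatible with every face in
  \<open>S\<close>.\<close>

lemma total_degree_UNIV: "total_degree (m :: 'v::finite \<Rightarrow>\<^sub>0 nat) =
    (\<Sum>x\<in>UNIV. Poly_Mapping.lookup m x)"
  unfolding total_degree_def by (rule sum.mono_neutral_left) (auto simp: in_keys_iff)

lemma total_degree_add: "total_degree (m + n :: 'v::finite \<Rightarrow>\<^sub>0 nat) =
    total_degree m + total_degree n"
  by (simp add: total_degree_UNIV lookup_add sum.distrib)

lemma total_degree_zero [simp]: "total_degree 0 = 0"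
  by (simp add: total_degree_def)

definition hom_part :: "int \<Rightarrow> ('v, 'k::field) mpoly \<Rightarrow> ('v, 'k) mpoly" where
  "hom_part j p = Poly_Mapping.mapp (\<lambda>m c. c when int (total_degree m) = j) p"

lemma lookup_hom_part:
  "Poly_Mapping.lookup (hom_part j p) m = (Poly_Mapping.lookup p m when int (total_degree m) = j)"
  by (auto simp: hom_part_def lookup_mapp when_def in_keys_iff)

lemma homogeneous_iff_hom_part: "homogeneous j p \<longleftrightarrow> hom_part j p = p"
  unfolding homogeneous_def poly_mapping_eq_iff fun_eq_iff
  by (auto simp: lookup_hom_part when_def in_keys_iff)

lemma homogeneous_hom_part [simp]: "homogeneous j (hom_part j p)"
  by (auto simp: homogeneous_def in_keys_iff lookup_hom_part)

lemma hom_part_add: "hom_part j (p + q) = hom_part j p + hom_part j q"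
  by (rule poly_mapping_eqI) (simp add: lookup_hom_part lookup_add when_def)

lemma hom_part_diff: "hom_part j (p - q) = hom_part j p - hom_part j q"
  by (rule poly_mapping_eqI) (simp add: lookup_hom_part lookup_minus when_def)

lemma hom_part_zero [simp]: "hom_part j 0 = 0"
  by (rule poly_mapping_eqI) (simp add: lookup_hom_part)

lemma hom_part_sum: "hom_part j (sum f A) = (\<Sum>x\<in>A. hom_part j (f x))"
  by (induction A rule: infinite_finite_induct) (simp_all add: hom_part_add)

text \<open>Only exponents \<open>l\<close> of degree \<open>e\<close> occur in \<open>p\<close>, so
  \<open>l + m\<close> has degree \<open>j\<close> exactly when \<open>m\<close> has degree
  \<open>j - e\<close>. This lets solutions of homogeneous linear equations be cut down to
  homogeneous ones.\<close>

lemma hom_part_mult_left: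
  fixes p q :: "('v::finite, 'k::field) mpoly"
  assumes "homogeneous e p"
  shows "hom_part j (p * q) = p * hom_part (j - e) q"
proof (rule poly_mapping_eqI)
  fix k
  have "Poly_Mapping.lookup p l *
        Sum_any (\<lambda>m. Poly_Mapping.lookup (hom_part (j - e) q) m when k = l + m) =
      (Poly_Mapping.lookup p l * Sum_any (\<lambda>m. Poly_Mapping.lookup q m when k = l + m)
        when int (total_degree k) = j)" for l
  proof (cases "Poly_Mapping.lookup p l = 0")
    case False
    then have "int (total_degree l) = e"
      using assms by (auto simp: homogeneous_def in_keys_iff)
    then have "(Poly_Mapping.lookup (hom_part (j - e) q) m when k = l + m) =
      ((Poly_Mapping.lookup q m when k = l + m) when int (total_degree k) = j)" for m
      by (auto simp: lookup_hom_part when_def total_degree_add)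
    then show ?thesis
      by (auto simp: when_def)
  qed auto
  then show "Poly_Mapping.lookup (hom_part j (p * q)) k =
      Poly_Mapping.lookup (p * hom_part (j - e) q) k"
    by (auto simp: lookup_mult lookup_hom_part when_def)
qed

lemma homogeneous_zero [simp]: "homogeneous j 0"
  by (simp add: homogeneous_def)

lemma homogeneous_diff: "homogeneous j p \<Longrightarrow> homogeneous j q \<Longrightarrow> homogeneous j (p - q)"
  by (simp add: homogeneous_iff_hom_part hom_part_diff)

lemma homogeneous_sum: "(\<And>x. x \<in> A \<Longrightarrow> homogeneous j (f x)) \<Longrightarrow> homogeneous j (sum f A)"
  by (simp add: homogeneous_iff_hom_part hom_part_sum)

lemma homogeneous_mult:
  fixes p q :: "('v::finite, 'k::field) mpoly"
  assumes "homogeneous e p" "homogeneous f q" "e + f = j"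
  shows "homogeneous j (p * q)"
  using assms by (auto simp: homogeneous_iff_hom_part hom_part_mult_left[OF assms(1)])

lemma homogeneous_single: "homogeneous (int (total_degree m)) (Poly_Mapping.single m c)"
  by (simp add: homogeneous_def)

lemma homogeneous_one [simp]: "homogeneous 0 (1 :: ('v, 'k::field) mpoly)"
  by (simp add: homogeneous_def)

lemma const_coeff_diff: "const_coeff (p - q) = const_coeff p - const_coeff q"
  by (simp add: const_coeff_def lookup_minus)

lemma const_coeff_zero [simp]: "const_coeff 0 = 0"
  by (simp add: const_coeff_def)

lemma const_coeff_sum: "const_coeff (sum f A) = (\<Sum>x\<in>A. const_coeff (f x))"
  by (simp add: const_coeff_def lookup_sum)

text \<open>A sum of exponent vectors is 0 only if both summands are. So \<open>const_coeff\<close>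
  is the ring map from R to \<open>k\<close>, and tensoring with \<open>k\<close> can be done
  entrywise.\<close>

lemma const_coeff_mult:
  fixes p q :: "('v::finite, 'k::field) mpoly"
  shows "const_coeff (p * q) = const_coeff p * const_coeff q"
proof -
  have *: "0 = l + m \<longleftrightarrow> l = 0 \<and> m = 0" for l m :: "'v \<Rightarrow>\<^sub>0 nat"
    by (auto simp: poly_mapping_eq_iff fun_eq_iff lookup_add)
  have "Sum_any (\<lambda>m. Poly_Mapping.lookup q m when 0 = l + m) = (Poly_Mapping.lookup q 0 when l = 0)"
      for l
    unfolding * by (cases "l = 0") simp_all
  then show ?thesis
    by (simp add: const_coeff_def lookup_mult mult_when)
qed

lemma const_coeff_homogeneous:
  assumes "homogeneous j p" "j \<noteq> 0"
  shows "const_coeff p = 0"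
proof (rule ccontr)
  assume "const_coeff p \<noteq> 0"
  then have "0 \<in> Poly_Mapping.keys p"
    by (simp add: const_coeff_def in_keys_iff)
  then show False
    using assms by (auto simp: homogeneous_def)
qed

section \<open>Comparison of graded free resolutions\<close>

definition comb :: "nat \<Rightarrow> (nat \<Rightarrow> 'r::comm_ring_1) \<Rightarrow> (nat \<Rightarrow> 'r) \<Rightarrow> 'r" where
  "comb r f v = (\<Sum>b<r. v b * f b)"

text \<open>A matrix is stored by columns: \<open>U b\<close> is the image of the
  \<open>b\<close>-th basis vector. A map out of a free module is thus given by choosing each
  \<open>U b\<close> separately, which the lifting arguments exploit.\<close>

definition lin :: "nat \<Rightarrow> (nat \<Rightarrow> nat \<Rightarrow> 'r::comm_ring_1) \<Rightarrow> (nat \<Rightarrow> 'r) \<Rightarrow> nat \<Rightarrow> 'r" where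
  "lin r U v a = comb r (\<lambda>b. U b a) v"

definition unit_vec :: "nat \<Rightarrow> nat \<Rightarrow> 'r::comm_ring_1" where
  "unit_vec b a = (if a = b then 1 else 0)"

text \<open>\<open>differential\<close> is unconstrained beyond the ranks; cutting the columns off
  at \<open>rank F i\<close> makes them elements of the free module.\<close>

definition diff_col :: "('r::comm_ring_1, 'm) free_complex \<Rightarrow> nat \<Rightarrow> nat \<Rightarrow> nat \<Rightarrow> 'r" where
  "diff_col F i b a = (if a < rank F i then differential F i a b else 0)"

lemma comb_cong: "(\<And>b. b < r \<Longrightarrow> f b = g b) \<Longrightarrow> comb r f v = comb r g v"
  by (simp add: comb_def)

lemma comb_diff_left: "comb r (\<lambda>b. f b - g b) v = comb r f v - comb r g v"
  by (simp add: comb_def algebra_simps sum_subtractf)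

lemma comb_diff: "comb r f (\<lambda>b. u b - v b) = comb r f u - comb r f v"
  by (simp add: comb_def algebra_simps sum_subtractf)

lemma comb_unit_vec: "b < r \<Longrightarrow> comb r f (unit_vec b) = f b"
  by (simp add: comb_def unit_vec_def sum.delta if_distrib[where f = "\<lambda>x. x * _"] cong: if_cong)

lemma comb_zero [simp]: "comb r f (\<lambda>_. 0) = 0" "comb r (\<lambda>_. 0) v = 0"
  by (simp_all add: comb_def)

lemma comb_lin: "comb s g (lin r U v) = comb r (\<lambda>b. comb s g (U b)) v"
proof -
  have "comb s g (lin r U v) = (\<Sum>c<s. \<Sum>b<r. v b * U b c * g c)"
    by (simp add: comb_def lin_def sum_distrib_right)
  also have "\<dots> = (\<Sum>b<r. \<Sum>c<s. v b * U b c * g c)"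
    by (rule sum.swap)
  finally show ?thesis
    by (simp add: comb_def sum_distrib_left mult.assoc)
qed

lemma lin_cong: "(\<And>b. b < r \<Longrightarrow> U b = Y b) \<Longrightarrow> lin r U v = lin r Y v"
  by (auto simp: lin_def fun_eq_iff intro!: comb_cong)

lemma lin_diff_left: "lin r (\<lambda>b a. U b a - Y b a) v = (\<lambda>a. lin r U v a - lin r Y v a)"
  by (simp add: lin_def fun_eq_iff comb_diff_left)

lemma lin_diff: "lin r U (\<lambda>b. u b - v b) = (\<lambda>a. lin r U u a - lin r U v a)"
  by (simp add: lin_def fun_eq_iff comb_diff)

lemma lin_zero [simp]: "lin r U (\<lambda>_. 0) = (\<lambda>_. 0)"
  by (simp add: lin_def fun_eq_iff)

lemma lin_lin: "lin s Y (lin r U v) = lin r (\<lambda>b. lin s Y (U b)) v"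
  by (rule ext) (simp add: lin_def comb_lin)

lemma lin_at_unit_vec: "b < r \<Longrightarrow> lin r U (unit_vec b) = U b"
  by (simp add: lin_def fun_eq_iff comb_unit_vec)

lemma lin_unit_vec: "v \<in> free_module r \<Longrightarrow> lin r unit_vec v = v"
  by (auto simp: lin_def comb_def unit_vec_def fun_eq_iff free_module_def
      if_distrib[where f = "\<lambda>x. _ * x"] cong: if_cong)

lemma lin_free: "(\<And>b. b < r \<Longrightarrow> U b \<in> free_module s) \<Longrightarrow> lin r U v \<in> free_module s"
  by (simp add: free_module_def lin_def comb_def)

lemma unit_vec_free: "b < r \<Longrightarrow> unit_vec b \<in> free_module r"
  by (simp add: free_module_def unit_vec_def)

lemma free_diff: "u \<in> free_module r \<Longrightarrow> v \<in> free_module r \<Longrightarrow>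
    (\<lambda>b. u b - v b :: 'r::comm_ring_1) \<in> free_module r"
  by (simp add: free_module_def)

lemma diff_map_lin: "diff_map F i = lin (rank F (Suc i)) (diff_col F i)"
  by (auto simp: fun_eq_iff diff_map_def lin_def comb_def diff_col_def mult.commute)

lemma diff_col_free: "diff_col F i b \<in> free_module (rank F i)"
  by (simp add: free_module_def diff_col_def)

lemma diff_map_free: "diff_map F i v \<in> free_module (rank F i)"
  by (simp add: diff_map_lin lin_free diff_col_free)

lemma diff_map_unit_vec: "b < rank F (Suc i) \<Longrightarrow> diff_map F i (unit_vec b) = diff_col F i b"
  by (simp add: diff_map_lin lin_at_unit_vec)

lemma diff_map_diff: "diff_map F i (\<lambda>b. u b - v b) = (\<lambda>a. diff_map F i u a - diff_map F i v a)"
  by (simp add: diff_map_lin lin_diff)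

lemma diff_map_lin_out: "diff_map F i (lin r U v) = lin r (\<lambda>b. diff_map F i (U b)) v"
  by (simp add: diff_map_lin lin_lin)

lemma lin_diff_map: "lin (rank F i) U (diff_map F i v) =
    lin (rank F (Suc i)) (\<lambda>b. lin (rank F i) U (diff_col F i b)) v"
  by (simp add: diff_map_lin lin_lin)

text \<open>The degree \<open>j\<close> component of the free module in position \<open>i\<close>.
  Coordinates beyond the rank are 0 and thus homogeneous of every degree, so \<open>a\<close>
  carries no bound.\<close>

definition homvec :: "(('v, 'k::field) mpoly, 'm) free_complex \<Rightarrow> nat \<Rightarrow> int \<Rightarrow>
    (nat \<Rightarrow> ('v, 'k) mpoly) \<Rightarrow> bool" where
  "homvec F i j v \<longleftrightarrow> v \<in> free_module (rank F i) \<and> (\<forall>a. homogeneous (j - basis_deg F i a) (v a))"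

lemma homvec_free: "homvec F i j v \<Longrightarrow> v \<in> free_module (rank F i)"
  by (simp add: homvec_def)

lemma homvec_diff: "homvec F i j u \<Longrightarrow> homvec F i j v \<Longrightarrow> homvec F i j (\<lambda>a. u a - v a)"
  by (simp add: homvec_def free_diff homogeneous_diff)

lemma homvec_unit_vec:
  "b < rank F i \<Longrightarrow> homvec (F :: (('v, 'k::field) mpoly, 'm) free_complex) i (basis_deg F i b) (unit_vec b)"
  unfolding homvec_def by (auto simp: unit_vec_free unit_vec_def)

lemma homogeneous_comb:
  fixes F :: "(('v::finite, 'k::field) mpoly, 'm) free_complex"
  assumes "homvec F i j v" "\<And>b. b < rank F i \<Longrightarrow> homogeneous (basis_deg F i b - e) (f b)"
  shows "homogeneous (j - e) (comb (rank F i) f v)"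
  unfolding comb_def
proof (intro homogeneous_sum)
  fix b assume "b \<in> {..<rank F i}"
  then show "homogeneous (j - e) (v b * f b)"
    using assms by (intro homogeneous_mult[where e = "j - basis_deg F i b"
          and f = "basis_deg F i b - e"])
      (auto simp: homvec_def)
qed

text \<open>A map that sends basis vectors to homogeneous elements respects the grading, so
  projecting the image amounts to projecting each coordinate, in a degree shifted by
  \<open>d b\<close>.\<close>

lemma hom_part_comb:
  fixes f :: "nat \<Rightarrow> ('v::finite, 'k::field) mpoly"
  assumes "\<And>b. b < r \<Longrightarrow> homogeneous (d b) (f b)"
  shows "hom_part j (comb r f v) = comb r f (\<lambda>b. hom_part (j - d b) (v b))"
  unfolding comb_def hom_part_sum
  by (intro sum.cong refl) (auto simp: mult.commute[of "v _"] hom_part_mult_left[OF assms] mult.commute)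

lemma homvec_lin:
  fixes P :: "(('v::finite, 'k::field) mpoly, 'm) free_complex"
  assumes "homvec P i j v" "\<And>b. b < rank P i \<Longrightarrow> homvec Q k (basis_deg P i b) (U b)"
  shows "homvec Q k j (lin (rank P i) U v)"
  using assms unfolding homvec_def
  by (auto intro!: lin_free) (auto simp: lin_def homvec_def intro!: homogeneous_comb)

text \<open>The closure conditions use the type class operations, so that the homological arguments
  stay clear of carriers; \<open>ideal_poly_ring\<close> makes the translation later.\<close>

locale homogeneous_ideal =
  fixes I :: "('v::finite, 'k::field) mpoly set"
  assumes zero_mem: "0 \<in> I"
    and add_mem: "p \<in> I \<Longrightarrow> q \<in> I \<Longrightarrow> p + q \<in> I"
    and mult_mem: "p \<in> I \<Longrightarrow> r * p \<in> I"
    and hom_part_mem: "p \<in> I \<Longrightarrow> hom_part j p \<in> I"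
begin

lemma diff_mem: "p \<in> I \<Longrightarrow> q \<in> I \<Longrightarrow> p - q \<in> I"
  using add_mem[of p "(-1) * q"] mult_mem[of q "-1"] by simp

lemma sum_mem: "(\<And>b. b \<in> B \<Longrightarrow> p b \<in> I) \<Longrightarrow> sum p B \<in> I"
  by (induction B rule: infinite_finite_induct) (auto intro: zero_mem add_mem)

lemma comb_mem: "(\<And>b. b < r \<Longrightarrow> f b \<in> I) \<Longrightarrow> comb r f v \<in> I"
  unfolding comb_def by (auto intro: sum_mem mult_mem)

text \<open>
  Here \<open>R/I\<close> is presented by representatives \<open>f b\<close> of the images of the basis elements of \<open>F\<^sub>0\<close>.
\<close>

definition syz :: "(nat \<Rightarrow> ('v, 'k) mpoly) \<Rightarrow> (('v, 'k) mpoly, 'm) free_complex \<Rightarrow> nat \<Rightarrow>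
    (nat \<Rightarrow> ('v, 'k) mpoly) set" where
  "syz f F i = {y \<in> free_module (rank F i).
     case i of 0 \<Rightarrow> comb (rank F 0) f y \<in> I | Suc i' \<Rightarrow> diff_map F i' y = (\<lambda>_. 0)}"

text \<open>This is \<open>graded_free_resolution\<close> for R/I with the augmentation replaced by
  representatives in R. Since \<open>syz\<close> treats position 0 like the others, exactness
  becomes a single condition.\<close>

definition resolves :: "(nat \<Rightarrow> ('v, 'k) mpoly) \<Rightarrow> (('v, 'k) mpoly, 'm) free_complex \<Rightarrow> bool" where
  "resolves f F \<longleftrightarrow>
     (\<forall>b<rank F 0. homogeneous (basis_deg F 0 b) (f b)) \<and>
     (\<forall>i. \<forall>a<rank F i. \<forall>b<rank F (Suc i).
        homogeneous (basis_deg F (Suc i) b - basis_deg F i a) (differential F i a b)) \<and>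
     (\<forall>g. \<exists>v\<in>free_module (rank F 0). comb (rank F 0) f v - g \<in> I) \<and>
     (\<forall>i. syz f F i = diff_map F i ` free_module (rank F (Suc i)))"

lemma resolves_exact:
  "resolves f F \<Longrightarrow> syz f F i = diff_map F i ` free_module (rank F (Suc i))"
  by (simp add: resolves_def)

lemma homvec_diff_col:
  assumes "resolves f F" "b < rank F (Suc i)"
  shows "homvec F i (basis_deg F (Suc i) b) (diff_col F i b)"
  using assms by (auto simp: homvec_def diff_col_free resolves_def) (auto simp: diff_col_def)

lemma diff_col_syz:
  assumes "resolves f F" "b < rank F (Suc i)"
  shows "diff_col F i b \<in> syz f F i"
  using unit_vec_free[OF assms(2)]
  by (auto simp: resolves_exact[OF assms(1)] simp flip: diff_map_unit_vec[OF assms(2)])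

text \<open>Any preimage of \<open>y\<close> will do once each of its coordinates is replaced by its
  part of the right degree: the homogeneous matrix sends the discarded parts to degrees in which
  \<open>y\<close> has no component.\<close>

lemma homvec_lift:
  fixes F :: "(('v, 'k) mpoly, 'm) free_complex"
  assumes F: "resolves f F" and y: "y \<in> syz f F i" "homvec F i j y"
  obtains x where "homvec F (Suc i) j x" "diff_map F i x = y"
proof -
  obtain u where u: "u \<in> free_module (rank F (Suc i))" "diff_map F i u = y"
    using y(1) by (auto simp: resolves_exact[OF F])
  define x where "x b = hom_part (j - basis_deg F (Suc i) b) (u b)" for b
  have x: "homvec F (Suc i) j x"
    using u(1) by (auto simp: homvec_def x_def free_module_def)
  have "diff_map F i x a = y a" for a
  proof -
    have "diff_map F i x a = comb (rank F (Suc i)) (\<lambda>b. diff_col F i b a)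
        (\<lambda>b. hom_part ((j - basis_deg F i a) - (basis_deg F (Suc i) b - basis_deg F i a)) (u b))"
      by (simp add: diff_map_lin lin_def x_def[abs_def])
    also have "\<dots> = hom_part (j - basis_deg F i a) (diff_map F i u a)"
      using homvec_diff_col[OF F]
      by (subst hom_part_comb[symmetric]) (auto simp: homvec_def diff_map_lin lin_def)
    finally show ?thesis
      using y(2) u(2) by (simp add: homvec_def homogeneous_iff_hom_part)
  qed
  then show ?thesis
    using x that by blast
qed

text \<open>The same truncation works at the augmentation, where images agree only modulo
  \<open>I\<close>: the error term is truncated along and stays in \<open>I\<close> because
  \<open>I\<close> is homogeneous.\<close>

lemma homvec_lift_aug:
  fixes F :: "(('v, 'k) mpoly, 'm) free_complex"
  assumes F: "resolves f F" and g: "homogeneous j g"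
  obtains x where "homvec F 0 j x" "comb (rank F 0) f x - g \<in> I"
proof -
  obtain u where u: "u \<in> free_module (rank F 0)" "comb (rank F 0) f u - g \<in> I"
    using F unfolding resolves_def by blast
  define x where "x b = hom_part (j - basis_deg F 0 b) (u b)" for b
  have x: "homvec F 0 j x"
    using u(1) by (auto simp: homvec_def x_def free_module_def)
  have "comb (rank F 0) f x = hom_part j (comb (rank F 0) f u)"
    unfolding x_def[abs_def]
    using F by (intro hom_part_comb[symmetric]) (simp add: resolves_def)
  then have "comb (rank F 0) f x - g = hom_part j (comb (rank F 0) f u - g)"
    using g by (simp add: hom_part_diff homogeneous_iff_hom_part)
  then show ?thesis
    using that[OF x] hom_part_mem[OF u(2)] by simp
qed

text \<open>The usual lifting argument: the images of basis vectors of \<open>P\<close> are chosen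
  one by one, and exactness of \<open>Q\<close> supplies them. The identities hold for all
  \<open>v\<close>, since the maps read only coordinates below the rank.\<close>

lemma chain_map_exists:
  fixes P :: "(('v, 'k) mpoly, 'm) free_complex" and Q :: "(('v, 'k) mpoly, 'n) free_complex"
  assumes P: "resolves f P" and Q: "resolves g Q"
  obtains U where
    "\<And>i b. b < rank P i \<Longrightarrow> homvec Q i (basis_deg P i b) (U i b)"
    "\<And>v. comb (rank Q 0) g (lin (rank P 0) (U 0) v) - comb (rank P 0) f v \<in> I"
    "\<And>i v. diff_map Q i (lin (rank P (Suc i)) (U (Suc i)) v) =
        lin (rank P i) (U i) (diff_map P i v)"
proof -
  \<comment> \<open>\<open>?A\<close> also records that cycles go to cycles. A column of the next
    differential of \<open>P\<close> is a cycle, so its image is a cycle of \<open>Q\<close>, which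
    has a preimage by exactness.\<close>
  let ?A = "\<lambda>i x. (\<forall>b<rank P i. homvec Q i (basis_deg P i b) (x b)) \<and>
       (\<forall>y\<in>syz f P i. lin (rank P i) x y \<in> syz g Q i) \<and>
       (i = 0 \<longrightarrow> (\<forall>v. comb (rank Q 0) g (lin (rank P 0) x v) - comb (rank P 0) f v \<in> I))"
  let ?B = "\<lambda>i x x'. \<forall>v. diff_map Q i (lin (rank P (Suc i)) x' v) =
      lin (rank P i) x (diff_map P i v)"
  have "\<exists>U. \<forall>i. ?A i (U i) \<and> ?B i (U i) (U (Suc i))"
  proof (rule dependent_nat_choice)
    have "\<forall>b. \<exists>x. b < rank P 0 \<longrightarrow> homvec Q 0 (basis_deg P 0 b) x \<and> comb (rank Q 0) g x - f b \<in> I"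
      using P homvec_lift_aug[OF Q] unfolding resolves_def by metis
    then obtain x where x: "\<And>b. b < rank P 0 \<Longrightarrow> homvec Q 0 (basis_deg P 0 b) (x b)"
      "\<And>b. b < rank P 0 \<Longrightarrow> comb (rank Q 0) g (x b) - f b \<in> I"
      by metis
    have c: "comb (rank Q 0) g (lin (rank P 0) x v) - comb (rank P 0) f v \<in> I" for v
      using comb_mem[OF x(2)] by (simp add: comb_lin comb_diff_left)
    have "lin (rank P 0) x y \<in> syz g Q 0" if "y \<in> syz f P 0" for y
      using add_mem[OF c[of y], of "comb (rank P 0) f y"] that x(1)
      by (auto simp: syz_def intro!: lin_free dest: homvec_free)
    then show "\<exists>x. ?A 0 x"
      using x c by blast
  next
    fix x i assume A: "?A i x"
    have "\<forall>b. \<exists>z. b < rank P (Suc i) \<longrightarrow> homvec Q (Suc i) (basis_deg P (Suc i) b) z \<and>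
        diff_map Q i z = lin (rank P i) x (diff_col P i b)"
    proof
      fix b
      have "b < rank P (Suc i) \<Longrightarrow> \<exists>z. homvec Q (Suc i) (basis_deg P (Suc i) b) z \<and>
        diff_map Q i z = lin (rank P i) x (diff_col P i b)"
        using A homvec_lift[OF Q, of "lin (rank P i) x (diff_col P i b)"] diff_col_syz[OF P] homvec_diff_col[OF P]
        by (metis homvec_lin)
      then show "\<exists>z. b < rank P (Suc i) \<longrightarrow> homvec Q (Suc i) (basis_deg P (Suc i) b) z \<and>
        diff_map Q i z = lin (rank P i) x (diff_col P i b)"
        by blast
    qed
    then obtain z where z: "\<And>b. b < rank P (Suc i) \<Longrightarrow> homvec Q (Suc i) (basis_deg P (Suc i) b) (z b)"
      "\<And>b. b < rank P (Suc i) \<Longrightarrow> diff_map Q i (z b) = lin (rank P i) x (diff_col P i b)"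
      by metis
    have B: "?B i x z"
      using z(2) by (auto simp: diff_map_lin_out lin_diff_map intro!: lin_cong)
    have "lin (rank P (Suc i)) z y \<in> syz g Q (Suc i)" if "y \<in> syz f P (Suc i)" for y
      using that z(1) B by (auto simp: syz_def intro!: lin_free dest: homvec_free)
    then show "\<exists>x'. ?A (Suc i) x' \<and> ?B i x x'"
      using B z(1) by blast
  qed
  then obtain U where U: "\<forall>i. ?A i (U i) \<and> ?B i (U i) (U (Suc i))"
    by (rule exE)
  show ?thesis
  proof (rule that[of U])
    show "homvec Q i (basis_deg P i b) (U i b)" if "b < rank P i" for i b
      using spec[OF U, of i] that by simp
    show "comb (rank Q 0) g (lin (rank P 0) (U 0) v) - comb (rank P 0) f v \<in> I" for v
      using spec[OF U, of 0] by simp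
    show "diff_map Q i (lin (rank P (Suc i)) (U (Suc i)) v) = lin (rank P i) (U i) (diff_map P i v)"
        for i v
      using spec[OF U, of i] by simp
  qed
qed

text \<open>\<open>T\<close> induces 0 on R/I, and \<open>H\<close> satisfies d H + H d = T while
  preserving internal degrees. The conditions \<open>T0\<close> and \<open>T_diff\<close> are
  restricted to the free module because the intended \<open>T\<close> contains the identity, and
  \<open>lin\<close> with \<open>unit_vec\<close> is the identity only there.\<close>

lemma null_homotopy_exists:
  fixes P :: "(('v, 'k) mpoly, 'm) free_complex"
  assumes P: "resolves f P"
    and T: "\<And>i b. b < rank P i \<Longrightarrow> homvec P i (basis_deg P i b) (T i b)"
    and T0: "\<And>v. v \<in> free_module (rank P 0) \<Longrightarrow> comb (rank P 0) f (lin (rank P 0) (T 0) v) \<in> I"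
    and T_diff: "\<And>i v. v \<in> free_module (rank P (Suc i)) \<Longrightarrow>
        diff_map P i (lin (rank P (Suc i)) (T (Suc i)) v) = lin (rank P i) (T i) (diff_map P i v)"
  obtains H where
    "\<And>i b. b < rank P i \<Longrightarrow> homvec P (Suc i) (basis_deg P i b) (H i b)"
    "\<And>v. diff_map P 0 (lin (rank P 0) (H 0) v) = lin (rank P 0) (T 0) v"
    "\<And>i v. diff_map P (Suc i) (lin (rank P (Suc i)) (H (Suc i)) v) =
       (\<lambda>a. lin (rank P (Suc i)) (T (Suc i)) v a - lin (rank P i) (H i) (diff_map P i v) a)"
proof -
  \<comment> \<open>The clause on \<open>syz\<close> says that d H = T on cycles. Applied to a
    column of the next differential, it shows that T - H d is again a cycle there, so exactness
    yields the next \<open>H\<close>.\<close>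
  let ?A = "\<lambda>i h. (\<forall>b<rank P i. homvec P (Suc i) (basis_deg P i b) (h b)) \<and>
       (\<forall>y\<in>syz f P i. diff_map P i (lin (rank P i) h y) = lin (rank P i) (T i) y) \<and>
       (i = 0 \<longrightarrow> (\<forall>v. diff_map P 0 (lin (rank P 0) h v) = lin (rank P 0) (T 0) v))"
  let ?B = "\<lambda>i h h'. \<forall>v. diff_map P (Suc i) (lin (rank P (Suc i)) h' v) =
       (\<lambda>a. lin (rank P (Suc i)) (T (Suc i)) v a - lin (rank P i) h (diff_map P i v) a)"
  have "\<exists>H. \<forall>i. ?A i (H i) \<and> ?B i (H i) (H (Suc i))"
  proof (rule dependent_nat_choice)
    have "\<exists>z. homvec P (Suc 0) (basis_deg P 0 b) z \<and> diff_map P 0 z = T 0 b" if b: "b < rank P 0"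
        for b
    proof -
      have "T 0 b \<in> syz f P 0"
        using T0[OF unit_vec_free[OF b]] homvec_free[OF T[OF b]] b
            by (simp add: syz_def lin_at_unit_vec)
      then show ?thesis
        using homvec_lift[OF P _ T[OF b]] by metis
    qed
    then have "\<forall>b. \<exists>z. b < rank P 0 \<longrightarrow> homvec P (Suc 0) (basis_deg P 0 b) z \<and> diff_map P 0 z = T 0 b"
      by blast
    then obtain h where h: "\<And>b. b < rank P 0 \<Longrightarrow> homvec P (Suc 0) (basis_deg P 0 b) (h b)"
      "\<And>b. b < rank P 0 \<Longrightarrow> diff_map P 0 (h b) = T 0 b"
      by metis
    then have "diff_map P 0 (lin (rank P 0) h v) = lin (rank P 0) (T 0) v" for v
      by (auto simp: diff_map_lin_out intro!: lin_cong)
    then show "\<exists>h. ?A 0 h"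
      using h(1) by blast
  next
    fix h i assume A: "?A i h"
    have "\<exists>z. homvec P (Suc (Suc i)) (basis_deg P (Suc i) b) z \<and>
        diff_map P (Suc i) z = (\<lambda>a. T (Suc i) b a - lin (rank P i) h (diff_col P i b) a)"
      if b: "b < rank P (Suc i)" for b
    proof -
      let ?y = "\<lambda>a. T (Suc i) b a - lin (rank P i) h (diff_col P i b) a"
      have hom: "homvec P (Suc i) (basis_deg P (Suc i) b) ?y"
        using A b by (intro homvec_diff T homvec_lin[OF homvec_diff_col[OF P b]]) auto
      have "diff_map P i (T (Suc i) b) = lin (rank P i) (T i) (diff_col P i b)"
        using T_diff[OF unit_vec_free[OF b]] b by (simp add: lin_at_unit_vec diff_map_unit_vec)
      then have "diff_map P i ?y = (\<lambda>_. 0)"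
        using A diff_col_syz[OF P b] by (simp add: diff_map_diff)
      then have "?y \<in> syz f P (Suc i)"
        using hom by (simp add: syz_def homvec_free)
      then show ?thesis
        using homvec_lift[OF P _ hom] by metis
    qed
    then have "\<forall>b. \<exists>z. b < rank P (Suc i) \<longrightarrow> homvec P (Suc (Suc i)) (basis_deg P (Suc i) b) z \<and>
        diff_map P (Suc i) z = (\<lambda>a. T (Suc i) b a - lin (rank P i) h (diff_col P i b) a)"
      by blast
    from choice[OF this] obtain h' where h': "\<And>b. b < rank P (Suc i) \<Longrightarrow>
        homvec P (Suc (Suc i)) (basis_deg P (Suc i) b) (h' b)"
      "\<And>b. b < rank P (Suc i) \<Longrightarrow>
        diff_map P (Suc i) (h' b) = (\<lambda>a. T (Suc i) b a - lin (rank P i) h (diff_col P i b) a)"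
      by blast
    have B: "?B i h h'"
    proof
      fix v
      have "diff_map P (Suc i) (lin (rank P (Suc i)) h' v) =
          lin (rank P (Suc i)) (\<lambda>b a. T (Suc i) b a - lin (rank P i) h (diff_col P i b) a) v"
        unfolding diff_map_lin_out by (intro lin_cong h')
      then show "diff_map P (Suc i) (lin (rank P (Suc i)) h' v) =
          (\<lambda>a. lin (rank P (Suc i)) (T (Suc i)) v a - lin (rank P i) h (diff_map P i v) a)"
        by (simp only: lin_diff_left lin_diff_map)
    qed
    moreover have "\<forall>y\<in>syz f P (Suc i). diff_map P (Suc i) (lin (rank P (Suc i)) h' y) =
        lin (rank P (Suc i)) (T (Suc i)) y"
      using B by (auto simp: syz_def)
    ultimately show "\<exists>h'. ?A (Suc i) h' \<and> ?B i h h'"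
      using h'(1) by blast
  qed
  then obtain H where H: "\<forall>i. ?A i (H i) \<and> ?B i (H i) (H (Suc i))"
    by (rule exE)
  show ?thesis
  proof (rule that[of H])
    show "homvec P (Suc i) (basis_deg P i b) (H i b)" if "b < rank P i" for i b
      using spec[OF H, of i] that by simp
    show "diff_map P 0 (lin (rank P 0) (H 0) v) = lin (rank P 0) (T 0) v" for v
      using spec[OF H, of 0] by simp
    show "diff_map P (Suc i) (lin (rank P (Suc i)) (H (Suc i)) v) =
        (\<lambda>a. lin (rank P (Suc i)) (T (Suc i)) v a - lin (rank P i) (H i) (diff_map P i v) a)"
            for i v
      using spec[OF H, of i] by simp
  qed
qed

end

section \<open>Reduction modulo the variables\<close>

lemma const_coeff_comb:
  fixes f :: "nat \<Rightarrow> ('v::finite, 'k::field) mpoly"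
  shows "const_coeff (comb r f v) = (\<Sum>b<r. const_coeff (f b) * const_coeff (v b))"
  by (simp add: comb_def const_coeff_sum const_coeff_mult mult.commute)

lemma const_coeff_lin:
  fixes Y :: "nat \<Rightarrow> nat \<Rightarrow> ('v::finite, 'k::field) mpoly"
  assumes "\<And>b. b < r \<Longrightarrow> const_coeff (v b) = 0"
  shows "const_coeff (lin r Y v a) = 0"
  by (simp add: lin_def const_coeff_comb assms)

lemma const_coeff_diff_map:
  fixes F :: "(('v::finite, 'k::field) mpoly, 'm) free_complex"
  shows "(\<lambda>a. const_coeff (diff_map F i v a)) = tensor_k_diff F i (\<lambda>b. const_coeff (v b))"
  by (auto simp: fun_eq_iff diff_map_lin lin_def const_coeff_comb tensor_k_diff_def diff_col_def)

text \<open>A coordinate that is homogeneous of nonzero degree has no constant term, so only the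
  coordinates at basis elements of degree \<open>j\<close> survive.\<close>

lemma const_coeff_homvec:
  assumes "homvec F i j v"
  shows "(\<lambda>b. const_coeff (v b)) \<in> tensor_k F i j"
  unfolding tensor_k_def
proof (intro CollectI allI impI conjI)
  fix b assume "const_coeff (v b) \<noteq> 0"
  moreover from this have "v b \<noteq> 0"
    by auto
  moreover have "homogeneous (j - basis_deg F i b) (v b)"
    using assms by (simp add: homvec_def)
  ultimately show "b < rank F i" "basis_deg F i b = j"
    using assms const_coeff_homogeneous[of "j - basis_deg F i b" "v b"]
    by (auto simp: homvec_def free_module_def not_le[symmetric])
qed

text \<open>Stated for a general operation \<open>h\<close> so that sums and differences are covered
  at once.\<close>

lemma tensor_k_pointwise:
  assumes "h 0 0 = 0" "x \<in> tensor_k F i j" "y \<in> tensor_k F i j"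
  shows "(\<lambda>b. h (x b) (y b)) \<in> tensor_k F i j"
  unfolding tensor_k_def
proof (intro CollectI allI impI)
  fix b assume "h (x b) (y b) \<noteq> 0"
  with assms(1) have "x b \<noteq> 0 \<or> y b \<noteq> 0"
    by auto
  with assms(2,3) show "b < rank F i \<and> basis_deg F i b = j"
    by (auto simp: tensor_k_def)
qed

text \<open>Boundaries are closed under sums and differences, so translating them by a cycle, which
  is itself a boundary, gives the same coset.\<close>

lemma homology_k_trivial:
  assumes "cycles_k F i j \<subseteq> boundaries_k F i j"
  shows "carrier (homology_k F i j) = {\<one>\<^bsub>homology_k F i j\<^esub>}"
proof -
  let ?Z = "cycles_k F i j" and ?B = "boundaries_k F i j"
  let ?G = "\<lparr>carrier = ?Z, monoid.mult = (\<lambda>u v a. u a + v a), one = (\<lambda>_. 0)\<rparr>"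
  have B: "(\<lambda>a. u a - v a) \<in> ?B" "(\<lambda>a. u a + v a) \<in> ?B" if uv: "u \<in> ?B" "v \<in> ?B" for u v
  proof -
    obtain x y where x: "x \<in> tensor_k F (Suc i) j" "u = tensor_k_diff F i x"
      and y: "y \<in> tensor_k F (Suc i) j" "v = tensor_k_diff F i y"
      using uv by (auto simp: boundaries_k_def)
    have "tensor_k_diff F i (\<lambda>b. x b - y b) \<in> ?B" "tensor_k_diff F i (\<lambda>b. x b + y b) \<in> ?B"
      using tensor_k_pointwise[of "\<lambda>s t. s - t", OF _ x(1) y(1)]
        tensor_k_pointwise[of "\<lambda>s t. s + t", OF _ x(1) y(1)]
      unfolding boundaries_k_def by (simp_all add: imageI)
    moreover have "tensor_k_diff F i (\<lambda>b. x b - y b) = (\<lambda>a. u a - v a)"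
      "tensor_k_diff F i (\<lambda>b. x b + y b) = (\<lambda>a. u a + v a)"
      by (auto simp: x(2) y(2) tensor_k_diff_def fun_eq_iff algebra_simps sum.distrib sum_subtractf)
    ultimately show "(\<lambda>a. u a - v a) \<in> ?B" "(\<lambda>a. u a + v a) \<in> ?B"
      by simp_all
  qed
  \<comment> \<open>The zero cycle shows that there is at least one coset.\<close>
  have "(\<lambda>_. 0) \<in> ?Z"
    by (auto simp: cycles_k_def tensor_k_def tensor_k_diff_def split: nat.splits)
  moreover have "?B #>\<^bsub>?G\<^esub> z = ?B" if "z \<in> ?Z" for z
  proof (intro subset_antisym subsetI)
    fix u assume u: "u \<in> ?B"
    have "(\<lambda>a. (u a - z a) + z a) \<in> ?B #>\<^bsub>?G\<^esub> z"
      unfolding r_coset_def using B(1)[OF u] that assms by (auto intro!: bexI[of _ "\<lambda>a. u a - z a"])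
    then show "u \<in> ?B #>\<^bsub>?G\<^esub> z"
      by simp
  next
    fix u assume "u \<in> ?B #>\<^bsub>?G\<^esub> z"
    then show "u \<in> ?B"
      using B(2) that assms by (auto simp: r_coset_def)
  qed
  ultimately show ?thesis
    by (auto simp: homology_k_def FactGroup_def RCOSETS_def)
qed

context homogeneous_ideal
begin

text \<open>
  Up to homotopy the identity of \<open>P\<close> factors through \<open>Q\<close>, and \<open>Q \<otimes> k\<close> vanishes in position \<open>(i, j)\<close>.
\<close>

lemma homology_k_trivial_of_resolution:
  fixes P :: "(('v, 'k) mpoly, 'm) free_complex" and Q :: "(('v, 'k) mpoly, 'n) free_complex"
  assumes P: "resolves f P" and Q: "resolves g Q"
    and deg: "\<And>b. b < rank Q i \<Longrightarrow> basis_deg Q i b \<noteq> j"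
  shows "carrier (homology_k P i j) = {\<one>\<^bsub>homology_k P i j\<^esub>}"
proof (intro homology_k_trivial subsetI)
  obtain U where
    U: "\<And>i b. b < rank P i \<Longrightarrow> homvec Q i (basis_deg P i b) (U i b)"
    "\<And>v. comb (rank Q 0) g (lin (rank P 0) (U 0) v) - comb (rank P 0) f v \<in> I"
    "\<And>i v. diff_map Q i (lin (rank P (Suc i)) (U (Suc i)) v) =
        lin (rank P i) (U i) (diff_map P i v)"
    using chain_map_exists[OF P Q] by blast
  obtain W where
    W: "\<And>i b. b < rank Q i \<Longrightarrow> homvec P i (basis_deg Q i b) (W i b)"
    "\<And>v. comb (rank P 0) f (lin (rank Q 0) (W 0) v) - comb (rank Q 0) g v \<in> I"
    "\<And>i v. diff_map P i (lin (rank Q (Suc i)) (W (Suc i)) v) =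
        lin (rank Q i) (W i) (diff_map Q i v)"
    using chain_map_exists[OF Q P] by blast
  \<comment> \<open>The identity of \<open>P\<close> minus the round trip through \<open>Q\<close>:
    a chain map that induces 0 on R/I.\<close>
  define T where "T i b a = unit_vec b a - lin (rank Q i) (W i) (U i b) a" for i b a
  have T_lin: "lin (rank P i) (T i) v = (\<lambda>a. v a - lin (rank Q i) (W i) (lin (rank P i) (U i) v) a)"
    if "v \<in> free_module (rank P i)" for i v
    unfolding T_def by (simp only: lin_diff_left lin_unit_vec[OF that] lin_lin)
  have T1: "homvec P i (basis_deg P i b) (T i b)" if "b < rank P i" for i b
    unfolding T_def by (intro homvec_diff homvec_unit_vec that homvec_lin[OF U(1)] W(1))
  have T2: "comb (rank P 0) f (lin (rank P 0) (T 0) v) \<in> I" if "v \<in> free_module (rank P 0)" for v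
  proof -
    let ?u = "lin (rank P 0) (U 0) v"
    have "comb (rank P 0) f (lin (rank P 0) (T 0) v) =
        0 - ((comb (rank P 0) f (lin (rank Q 0) (W 0) ?u) - comb (rank Q 0) g ?u) +
          (comb (rank Q 0) g ?u - comb (rank P 0) f v))"
      by (simp add: T_lin[OF that] comb_diff)
    then show ?thesis
      using U(2) W(2) by (simp only: diff_mem add_mem zero_mem)
  qed
  have T3: "diff_map P i (lin (rank P (Suc i)) (T (Suc i)) v) =
      lin (rank P i) (T i) (diff_map P i v)"
    if "v \<in> free_module (rank P (Suc i))" for i v
    by (simp add: T_lin that diff_map_free diff_map_diff W(3) U(3))
  obtain H where
    H: "\<And>i b. b < rank P i \<Longrightarrow> homvec P (Suc i) (basis_deg P i b) (H i b)"
    "\<And>v. diff_map P 0 (lin (rank P 0) (H 0) v) = lin (rank P 0) (T 0) v"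
    "\<And>i v. diff_map P (Suc i) (lin (rank P (Suc i)) (H (Suc i)) v) =
       (\<lambda>a. lin (rank P (Suc i)) (T (Suc i)) v a - lin (rank P i) (H i) (diff_map P i v) a)"
    using null_homotopy_exists[OF P T1 T2 T3] by blast

  fix u assume u: "u \<in> cycles_k P i j"
  then have u_tensor: "u \<in> tensor_k P i j"
    by (auto simp: cycles_k_def split: nat.splits)
  \<comment> \<open>The cycle over \<open>k\<close> is lifted to constant polynomials. The lift has
    degree \<open>j\<close> but need not be a cycle over R.\<close>
  define v where "v b = (Poly_Mapping.single 0 (u b) :: ('v, 'k) mpoly)" for b
  have v: "homvec P i j v"
    unfolding homvec_def
  proof (intro conjI allI)
    show "v \<in> free_module (rank P i)"
      using u_tensor unfolding v_def tensor_k_def free_module_def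
      by (auto simp: not_less[symmetric]) (metis single_zero)
    show "homogeneous (j - basis_deg P i a) (v a)" for a
      using u_tensor by (cases "u a = 0") (auto simp: v_def tensor_k_def homogeneous_def)
  qed
  have const_v: "const_coeff (v b) = u b" for b
    by (simp add: v_def const_coeff_def)
  have "homvec Q i j (lin (rank P i) (U i) v)"
    by (rule homvec_lin[OF v U(1)])
  \<comment> \<open>Position \<open>i\<close> of \<open>Q\<close> has no basis element of degree
    \<open>j\<close>, so the image of \<open>v\<close> in \<open>Q\<close> reduces to 0, and
    \<open>T\<close> acts on \<open>u\<close> as the identity.\<close>
  then have "const_coeff (lin (rank P i) (U i) v b) = 0" if "b < rank Q i" for b
    using deg[OF that] by (auto simp: homvec_def intro!: const_coeff_homogeneous[of "j - basis_deg Q i b"])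
  then have const_T: "const_coeff (lin (rank P i) (T i) v a) = u a" for a
    by (simp add: T_lin[OF homvec_free[OF v]] const_coeff_diff const_v const_coeff_lin)
  \<comment> \<open>Its reduction is the required preimage of \<open>u\<close>: d H v = T v - H d v,
    where d v reduces to 0; in position 0 the last term is absent.\<close>
  let ?h = "lin (rank P i) (H i) v"
  have "const_coeff (diff_map P i ?h a) = u a" for a
  proof (cases i)
    case 0
    then show ?thesis
      using H(2) const_T by simp
  next
    case (Suc i')
    have "tensor_k_diff P i' u = (\<lambda>_. 0)"
      using u by (simp add: Suc cycles_k_def)
    then have "const_coeff (diff_map P i' v b) = 0" for b
      using const_coeff_diff_map[of P i' v] by (simp add: const_v fun_eq_iff)
    then show ?thesis
      using H(3)[of i' v] const_T by (simp add: Suc const_coeff_diff const_coeff_lin)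
  qed
  then have "u = tensor_k_diff P i (\<lambda>b. const_coeff (?h b))"
    by (simp flip: const_coeff_diff_map)
  moreover have "homvec P (Suc i) j ?h"
    by (rule homvec_lin[OF v H(1)])
  ultimately show "u \<in> boundaries_k P i j"
    unfolding boundaries_k_def using const_coeff_homvec by blast
qed

end

section \<open>The chain complex of a simplex\<close>

locale ordered_simplex =
  fixes V :: "'e set" and ord :: "'e \<Rightarrow> nat"
  assumes finite_V: "finite V" and inj_ord: "inj_on ord V"
begin

text \<open>The sign of the position of \<open>x\<close> in \<open>insert x A\<close>. As the
  comparison is strict, it does not depend on whether \<open>x\<close> lies in
  \<open>A\<close>.\<close>

definition sgn_at :: "'e \<Rightarrow> 'e set \<Rightarrow> 'k::comm_ring_1" where
  "sgn_at x A = (-1) ^ card {y \<in> A. ord y < ord x}"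

text \<open>Chains are coefficient functions, so the coefficient of \<open>A\<close> in the boundary
  gathers all simplices having \<open>A\<close> as a facet. \<open>A = {}\<close> is included: this
  is the augmented complex.\<close>

definition bd :: "('e set \<Rightarrow> 'k::comm_ring_1) \<Rightarrow> 'e set \<Rightarrow> 'k" where
  "bd c A = (\<Sum>x\<in>V - A. sgn_at x A * c (insert x A))"

text \<open>The join with \<open>p\<close>: a simplex avoiding \<open>p\<close> goes, up to sign, to
  itself with \<open>p\<close> added, and one containing \<open>p\<close> goes to 0.\<close>

definition cone :: "'e \<Rightarrow> ('e set \<Rightarrow> 'k::comm_ring_1) \<Rightarrow> 'e set \<Rightarrow> 'k" where
  "cone p c A = (if p \<in> A then sgn_at p A * c (A - {p}) else 0)"

lemma sgn_at_sq: "sgn_at x A * sgn_at x A = 1"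
  by (simp add: sgn_at_def flip: power_mult_distrib)

lemma sgn_at_insert_same: "sgn_at x (insert x A) = sgn_at x A"
  by (auto simp: sgn_at_def intro!: arg_cong[where f = "\<lambda>B. (-1) ^ card B"])

lemma sgn_at_insert:
  assumes "finite A" "y \<notin> A"
  shows "sgn_at x (insert y A) = (if ord y < ord x then - sgn_at x A else sgn_at x A)"
proof -
  have "{z \<in> insert y A. ord z < ord x} =
      (if ord y < ord x then insert y {z \<in> A. ord z < ord x} else {z \<in> A. ord z < ord x})"
    by auto
  then show ?thesis
    using assms by (simp add: sgn_at_def)
qed

text \<open>Exactly one of \<open>x\<close> and \<open>y\<close> precedes the other, so exactly one
  of them changes the sign of the other when it is inserted.\<close>

lemma sgn_at_swap:
  assumes "A \<subseteq> V" "x \<in> V - A" "y \<in> V - A" "x \<noteq> y"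
  shows "sgn_at x A * sgn_at y (insert x A) = - (sgn_at y A * sgn_at x (insert y A))"
proof -
  have "finite A" "ord x \<noteq> ord y"
    using assms finite_V finite_subset inj_onD[OF inj_ord, of x y] by auto
  then show ?thesis
    using assms by (auto simp: sgn_at_insert mult.commute)
qed

lemma sgn_at_swap':
  assumes "A \<subseteq> V" "x \<in> V - A" "y \<in> V - A" "x \<noteq> y"
  shows "sgn_at x (insert y A) * sgn_at y (insert x A) = - (sgn_at y A * sgn_at x A)"
proof -
  have "finite A" "ord x \<noteq> ord y"
    using assms finite_V finite_subset inj_onD[OF inj_ord, of x y] by auto
  then show ?thesis
    using assms by (auto simp: sgn_at_insert mult.commute)
qed

lemma bd_bd:
  fixes c :: "'e set \<Rightarrow> 'b::comm_ring_1"
  assumes A: "A \<subseteq> V"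
  shows "bd (bd c) A = 0"
proof -
  \<comment> \<open>In characteristic 2 antisymmetry alone does not make the sum vanish, so its terms are paired up.\<close>
  define g where "g x y = sgn_at x A * sgn_at y (insert x A) * c (insert y (insert x A))" for x y
  let ?D = "{(x, y). x \<in> V - A \<and> y \<in> V - A \<and> x \<noteq> y}"
  let ?L = "{(x, y) \<in> ?D. ord x < ord y}" and ?G = "{(x, y) \<in> ?D. ord y < ord x}"
  have fin: "finite ?D"
    by (rule finite_subset[of _ "V \<times> V"]) (auto simp: finite_V)
  have "bd (bd c) A = (\<Sum>x\<in>V - A. \<Sum>y\<in>V - insert x A. g x y)"
    by (simp add: bd_def sum_distrib_left g_def mult.assoc)
  also have "\<dots> = (\<Sum>(x, y)\<in>(SIGMA x:V - A. V - insert x A). g x y)"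
    by (rule sum.Sigma) (auto simp: finite_V)
  also have "(SIGMA x:V - A. V - insert x A) = ?L \<union> ?G"
    using inj_onD[OF inj_ord] by auto (metis linorder_neqE_nat)
  also have "(\<Sum>(x, y)\<in>?L \<union> ?G. g x y) = (\<Sum>(x, y)\<in>?L. g x y) + (\<Sum>(x, y)\<in>?G. g x y)"
    by (rule sum.union_disjoint) (auto intro: finite_subset[OF _ fin])
  also have "(\<Sum>(x, y)\<in>?G. g x y) = (\<Sum>(x, y)\<in>?L. - g x y)"
  proof (rule sum.reindex_bij_witness[of _ prod.swap prod.swap])
    fix z assume "z \<in> ?G"
    then obtain x y where z: "z = (x, y)" "x \<in> V - A" "y \<in> V - A" "x \<noteq> y"
      by auto
    have "sgn_at x A * sgn_at y (insert x A) = - (sgn_at y A * sgn_at x (insert y A) :: 'b)"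
      by (rule sgn_at_swap[OF A z(2-4)])
    then show "(case prod.swap z of (x, y) \<Rightarrow> - g x y) = (case z of (x, y) \<Rightarrow> g x y)"
      by (simp add: z(1) g_def insert_commute)
  qed auto
  also have "\<dots> = - (\<Sum>(x, y)\<in>?L. g x y)"
    by (simp add: sum_negf case_prod_beta)
  finally show ?thesis
    by (simp only: add.right_inverse)
qed

text \<open>Joining with \<open>p\<close> contracts the simplex. If \<open>p\<close> is not in
  \<open>A\<close>, only the term x = \<open>p\<close> in the boundary of the cone survives. If it
  is, the term x = \<open>p\<close> in \<open>bd c (A - {p})\<close> returns \<open>c A\<close>, and
  the other terms cancel the boundary of the cone by \<open>sgn_at_swap'\<close>.\<close>

lemma bd_cone:
  fixes c :: "'e set \<Rightarrow> 'b::comm_ring_1"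
  assumes A: "A \<subseteq> V" and p: "p \<in> V"
  shows "bd (cone p c) A + cone p (bd c) A = c A"
proof (cases "p \<in> A")
  case False
  have "bd (cone p c) A = (\<Sum>x\<in>V - A. if x = p then c A else 0)"
    unfolding bd_def
  proof (rule sum.cong[OF refl])
    fix x assume x: "x \<in> V - A"
    have "sgn_at p A * (sgn_at p (insert p A) * c (insert p A - {p})) = c A"
      using False by (simp add: sgn_at_insert_same sgn_at_sq flip: mult.assoc)
    then show "sgn_at x A * cone p c (insert x A) = (if x = p then c A else 0)"
      using False by (auto simp: cone_def)
  qed
  also have "\<dots> = c A"
    using False p by (simp add: finite_V)
  finally show ?thesis
    using False by (simp add: cone_def)
next
  case True
  define B where "B = A - {p}"
  have AB: "A = insert p B" "p \<notin> B" "B \<subseteq> V"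
    using True A by (auto simp: B_def)
  have "bd c B = sgn_at p B * c A + (\<Sum>x\<in>V - A. sgn_at x B * c (insert x B))"
    unfolding bd_def using AB p finite_V by (subst sum.remove[of _ p])
        (auto simp: insert_Diff_if intro!: sum.cong)
  then have "cone p (bd c) A = sgn_at p B * (sgn_at p B * c A) +
      (\<Sum>x\<in>V - A. sgn_at p B * (sgn_at x B * c (insert x B)))"
    using AB by (simp add: cone_def sgn_at_insert_same algebra_simps sum_distrib_left)
  also have "sgn_at p B * (sgn_at p B * c A) = c A"
    by (simp add: sgn_at_sq flip: mult.assoc)
  also have "(\<Sum>x\<in>V - A. sgn_at p B * (sgn_at x B * c (insert x B))) = - bd (cone p c) A"
    unfolding bd_def sum_negf[symmetric]
  proof (rule sum.cong[OF refl])
    fix x assume x: "x \<in> V - A"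
    have "sgn_at x A * cone p c (insert x A) =
        sgn_at x (insert p B) * sgn_at p (insert x B) * c (insert x B)"
    proof -
      have "insert x A = insert p (insert x B)" "insert x A - {p} = insert x B"
        using x AB by auto
      then show ?thesis
        by (simp add: cone_def sgn_at_insert_same AB(1) mult.assoc)
    qed
    also have "sgn_at x (insert p B) * sgn_at p (insert x B) = - (sgn_at p B * sgn_at x B :: 'b)"
      using x AB p by (intro sgn_at_swap') auto
    finally show "sgn_at p B * (sgn_at x B * c (insert x B)) =
        - (sgn_at x A * cone p c (insert x A))"
      by (simp add: mult.assoc)
  qed
  finally show ?thesis
    by simp
qed

end

section \<open>Taylor complexes supported on a simplicial complex\<close>

definition ind :: "'v set \<Rightarrow> 'v::finite \<Rightarrow>\<^sub>0 nat" where
  "ind S = (\<Sum>x\<in>S. Poly_Mapping.single x 1)"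

definition sqfree_monom :: "'v::finite set \<Rightarrow> ('v, 'k::field) mpoly" where
  "sqfree_monom S = Poly_Mapping.single (ind S) 1"

lemma lookup_ind: "Poly_Mapping.lookup (ind S) x = (if x \<in> S then 1 else 0)"
  by (simp add: ind_def lookup_sum lookup_single when_def)

lemma prod_var: "(\<Prod>x\<in>S. var x) = sqfree_monom S"
proof -
  have "finite S"
    by simp
  then show ?thesis
    by (induction S rule: finite_induct) (simp_all add: sqfree_monom_def ind_def var_def mult_single)
qed

lemma total_degree_ind: "total_degree (ind S) = card S"
  by (simp add: total_degree_UNIV lookup_ind flip: sum.inter_filter)

lemma homogeneous_sqfree_monom: "homogeneous (int (card S)) (sqfree_monom S)"
  by (metis homogeneous_single sqfree_monom_def total_degree_ind)

text \<open>Subtraction of exponent vectors is truncated; the inclusion says that the squarefree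
  monomial of \<open>S\<close> divides, so that nothing is cut off.\<close>

lemma diff_ind_add: "S \<subseteq> Poly_Mapping.keys a \<Longrightarrow> a - ind S + ind S = a"
  by (rule poly_mapping_eqI) (auto simp: lookup_add lookup_minus lookup_ind in_keys_iff dest!: subsetD)

lemma ind_diff_add:
  assumes "S \<subseteq> T" "T \<subseteq> Poly_Mapping.keys a"
  shows "ind (T - S) + (a - ind T) = a - ind S"
  by (rule poly_mapping_eqI) (use assms in \<open>auto simp: lookup_add lookup_minus lookup_ind in_keys_iff dest!: subsetD\<close>)

lemma subset_keys_add_ind: "S \<subseteq> Poly_Mapping.keys (m + ind S)"
  by (auto simp: in_keys_iff lookup_add lookup_ind)

text \<open>\<open>S\<close> stands for the support of a multidegree, to which exactly the faces
  with \<open>\<Union>A \<subseteq> S\<close> contribute. The apex has to lie in \<open>S\<close> so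
  that coning stays in that multidegree.\<close>

locale conical_complex = ordered_simplex V ord
  for V :: "'v::finite set set" and ord :: "'v set \<Rightarrow> nat" +
  fixes \<Delta> :: "'v set set set"
  assumes empty_face: "{} \<in> \<Delta>"
    and vertex_face: "E \<in> V \<Longrightarrow> {E} \<in> \<Delta>"
    and face_subset: "A \<in> \<Delta> \<Longrightarrow> A \<subseteq> V"
    and face_down: "A \<in> \<Delta> \<Longrightarrow> B \<subseteq> A \<Longrightarrow> B \<in> \<Delta>"
    and apex_exists: "E \<in> V \<Longrightarrow> E \<subseteq> S \<Longrightarrow>
      \<exists>p\<in>V. p \<subseteq> S \<and> (\<forall>A\<in>\<Delta>. \<Union>A \<subseteq> S \<longrightarrow> insert p A \<in> \<Delta>)"
begin

text \<open>Taylor's differential in the coefficient form of \<open>bd\<close>. Unions give least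
  common multiples of squarefree monomials, so the monomial factor is a quotient of two of them. The
  complex \<open>\<Delta>\<close> enters only through the support of \<open>g\<close>.\<close>

definition mdiff :: "('v set set \<Rightarrow> ('v, 'k::field) mpoly) \<Rightarrow> 'v set set \<Rightarrow> ('v, 'k) mpoly" where
  "mdiff g C = (\<Sum>x\<in>V - C. sgn_at x C * sqfree_monom (\<Union>(insert x C) - \<Union>C) * g (insert x C))"

text \<open>
  \<open>c C a\<close> is the coefficient of the element of multidegree \<open>a\<close> in the span of the basis element \<open>e\<^sub>C\<close>,
  which has multidegree \<open>ind (\<Union>C)\<close>.
\<close>

definition from_multidegrees ::
    "('v \<Rightarrow>\<^sub>0 nat) set \<Rightarrow> ('v set set \<Rightarrow> ('v \<Rightarrow>\<^sub>0 nat) \<Rightarrow> 'k::field) \<Rightarrow> 'v set set \<Rightarrow> ('v, 'k) mpoly" where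
  "from_multidegrees D c C = (\<Sum>a\<in>D. Poly_Mapping.single (a - ind (\<Union>C)) (c C a))"

text \<open>Multidegree \<open>a\<close> occurs in the span of the basis element of \<open>C\<close>
  only if the monomial of \<open>\<Union>C\<close> divides it; this keeps the truncated
  \<open>a - ind (\<Union>C)\<close> faithful.\<close>

definition divisible :: "('v set set \<Rightarrow> ('v \<Rightarrow>\<^sub>0 nat) \<Rightarrow> 'k::field) \<Rightarrow> bool" where
  "divisible c \<longleftrightarrow> (\<forall>C a. c C a \<noteq> 0 \<longrightarrow> \<Union>C \<subseteq> Poly_Mapping.keys a)"

lemma divisible_bd: "divisible c \<Longrightarrow> divisible (\<lambda>C a. bd (\<lambda>B. c B a) C)"
  unfolding divisible_def bd_def
  by (metis (no_types, lifting) Sup_insert le_supE mult_zero_right sum.neutral)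

lemma sgn_at_single: "sgn_at x C * Poly_Mapping.single m c =
    Poly_Mapping.single m (sgn_at x C * c :: 'k::field)"
  unfolding sgn_at_def by (cases "even (card {y \<in> C. ord y < ord x})") (simp_all add: single_uminus)

text \<open>The monomial factor makes up the difference between the multidegrees of the two basis
  elements. In each multidegree only the signs remain, that is, the simplicial boundary over the
  field.\<close>

lemma mdiff_from_multidegrees:
  assumes "divisible c"
  shows "mdiff (from_multidegrees D c) C = from_multidegrees D (\<lambda>C a. bd (\<lambda>B. c B a) C) C"
proof -
  have "sgn_at x C * sqfree_monom (\<Union>(insert x C) - \<Union>C) * from_multidegrees D c (insert x C) =
      (\<Sum>a\<in>D. Poly_Mapping.single (a - ind (\<Union>C)) (sgn_at x C * c (insert x C) a))" for x
  proof -
    have "sqfree_monom (\<Union>(insert x C) - \<Union>C) * Poly_Mapping.single (a - ind (\<Union>(insert x C))) (c (insert x C) a) =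
        Poly_Mapping.single (a - ind (\<Union>C)) (c (insert x C) a)" for a
    proof (cases "c (insert x C) a = 0")
      case False
      then have "\<Union>(insert x C) \<subseteq> Poly_Mapping.keys a"
        using assms by (auto simp: divisible_def)
      then have "ind (\<Union>(insert x C) - \<Union>C) + (a - ind (\<Union>(insert x C))) = a - ind (\<Union>C)"
        by (intro ind_diff_add) auto
      then show ?thesis
        by (simp add: sqfree_monom_def mult_single)
    qed simp
    then show ?thesis
      by (simp add: from_multidegrees_def sum_distrib_left mult.assoc sgn_at_single)
  qed
  then have "mdiff (from_multidegrees D c) C =
      (\<Sum>x\<in>V - C. \<Sum>a\<in>D. Poly_Mapping.single (a - ind (\<Union>C)) (sgn_at x C * c (insert x C) a))"
    by (simp add: mdiff_def)
  also have "\<dots> = (\<Sum>a\<in>D. \<Sum>x\<in>V - C. Poly_Mapping.single (a - ind (\<Union>C)) (sgn_at x C * c (insert x C) a))"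
    by (rule sum.swap)
  also have "\<dots> = from_multidegrees D (\<lambda>C a. bd (\<lambda>B. c B a) C) C"
    unfolding from_multidegrees_def bd_def
  proof (rule sum.cong[OF refl])
    fix a
    show "(\<Sum>x\<in>V - C. Poly_Mapping.single (a - ind (\<Union>C)) (sgn_at x C * c (insert x C) a)) =
        Poly_Mapping.single (a - ind (\<Union>C)) (\<Sum>x\<in>V - C. sgn_at x C * c (insert x C) a)"
      by (rule poly_mapping_eqI) (simp add: lookup_sum lookup_single when_def)
  qed
  finally show ?thesis .
qed

text \<open>For divisible \<open>c\<close> the multidegree is recovered from the exponent
  \<open>a - ind (\<Union>C)\<close>, so no two nonzero terms collide.\<close>

lemma lookup_from_multidegrees:
  assumes "finite D" "divisible c"
  shows "Poly_Mapping.lookup (from_multidegrees D c C) m =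
    (if m + ind (\<Union>C) \<in> D then c C (m + ind (\<Union>C)) else 0)"
proof -
  have "(c C a when a - ind (\<Union>C) = m) = (if a = m + ind (\<Union>C) then c C a else 0)" for a
  proof (cases "c C a = 0")
    case False
    then have "a - ind (\<Union>C) + ind (\<Union>C) = a"
      using assms(2) by (auto simp: divisible_def intro!: diff_ind_add)
    then show ?thesis
      by (auto simp: when_def)
  qed (auto simp: when_def)
  then show ?thesis
    using assms(1) by (simp add: from_multidegrees_def lookup_sum lookup_single)
qed

lemma from_multidegrees_eq_0D:
  assumes "finite D" "divisible c" "from_multidegrees D c C = 0" "a \<in> D"
  shows "c C a = 0"
proof (rule ccontr)
  assume *: "c C a \<noteq> 0"
  then have "a - ind (\<Union>C) + ind (\<Union>C) = a"
    using assms(2) by (auto simp: divisible_def intro!: diff_ind_add)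
  then show False
    using lookup_from_multidegrees[OF assms(1,2), of C "a - ind (\<Union>C)"] assms * by simp
qed

text \<open>Splitting into multihomogeneous pieces reduces statements about \<open>mdiff\<close> to
  statements about \<open>bd\<close>. The set \<open>D\<close> collects the multidegrees occurring
  over subsets of \<open>V\<close>.\<close>

lemma from_multidegrees_exists:
  obtains D c where "finite D" "divisible c" "\<And>C. C \<subseteq> V \<Longrightarrow> from_multidegrees D c C = g C"
    "\<And>C a. c C a \<noteq> 0 \<Longrightarrow> g C \<noteq> 0"
proof -
  define D where "D = (\<Union>C\<in>Pow V. (\<lambda>m. m + ind (\<Union>C)) ` Poly_Mapping.keys (g C))"
  define c where "c C a = (if \<Union>C \<subseteq> Poly_Mapping.keys a then Poly_Mapping.lookup (g C) (a - ind (\<Union>C)) else 0)" for C a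
  have D: "finite D"
    by (simp add: D_def finite_V)
  have c: "divisible c"
    by (auto simp: divisible_def c_def)
  have "from_multidegrees D c C = g C" if "C \<subseteq> V" for C
  proof (rule poly_mapping_eqI)
    fix m
    show "Poly_Mapping.lookup (from_multidegrees D c C) m = Poly_Mapping.lookup (g C) m"
      unfolding lookup_from_multidegrees[OF D c]
      using that subset_keys_add_ind[of "\<Union>C" m] by (force simp: c_def D_def in_keys_iff)
  qed
  moreover have "g C \<noteq> 0" if "c C a \<noteq> 0" for C a
    using that by (auto simp: c_def split: if_splits)
  ultimately show ?thesis
    using that[OF D c] by blast
qed

lemma mdiff_cong:
  assumes "C \<subseteq> V" "\<And>B. B \<subseteq> V \<Longrightarrow> g B = h B"
  shows "mdiff g C = mdiff h C"
  unfolding mdiff_def using assms by (intro sum.cong refl arg_cong2[where f = "(*)"]) auto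

lemma mdiff_mdiff:
  assumes "C \<subseteq> V"
  shows "mdiff (mdiff g) C = 0"
proof -
  obtain D c where D: "finite D" "divisible c" "\<And>C. C \<subseteq> V \<Longrightarrow> from_multidegrees D c C = g C"
    using from_multidegrees_exists[of g] by metis
  let ?c = "\<lambda>C a. bd (\<lambda>B. c B a) C"
  have "mdiff g B = from_multidegrees D ?c B" if "B \<subseteq> V" for B
    using mdiff_cong[OF that, of g "from_multidegrees D c"] D mdiff_from_multidegrees[OF D(2)]
        by simp
  then have "mdiff (mdiff g) C = mdiff (from_multidegrees D ?c) C"
    by (rule mdiff_cong[OF assms])
  also have "\<dots> = from_multidegrees D (\<lambda>C a. bd (\<lambda>B. ?c B a) C) C"
    by (rule mdiff_from_multidegrees[OF divisible_bd[OF D(2)]])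
  also have "\<dots> = 0"
    by (simp add: from_multidegrees_def bd_bd[OF assms])
  finally show ?thesis .
qed

definition faces :: "nat \<Rightarrow> 'v set set set" where
  "faces i = {C \<in> \<Delta>. card C = i}"

definition supported :: "nat \<Rightarrow> ('v set set \<Rightarrow> ('v, 'k::field) mpoly) \<Rightarrow> bool" where
  "supported i g \<longleftrightarrow> (\<forall>C. g C \<noteq> 0 \<longrightarrow> C \<in> faces i)"

lemma mdiff_exact:
  fixes g :: "'v set set \<Rightarrow> ('v, 'b::field) mpoly"
  assumes g: "supported (Suc i) g" and dg: "\<And>C. C \<in> faces i \<Longrightarrow> mdiff g C = 0"
  obtains h where "supported (Suc (Suc i)) h" "\<And>C. C \<subseteq> V \<Longrightarrow> mdiff h C = g C"
proof -
  obtain D c where D: "finite D" "divisible c" "\<And>C. C \<subseteq> V \<Longrightarrow> from_multidegrees D c C = g C"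
    and c: "\<And>C a. c C a \<noteq> 0 \<Longrightarrow> g C \<noteq> 0"
    using from_multidegrees_exists[of g] by metis
  have c_face: "C \<in> faces (Suc i)" if "c C a \<noteq> 0" for C a
    using c[OF that] g by (simp add: supported_def)
  \<comment> \<open>By \<open>face_down\<close>, a set outside \<open>faces i\<close> is not a facet
    of any member of \<open>faces (Suc i)\<close>, so the vanishing extends from
    \<open>faces i\<close> to all subsets of \<open>V\<close>.\<close>
  have bd0: "bd (\<lambda>B. c B a) C = 0" if C: "C \<subseteq> V" and a: "a \<in> D" for C a
  proof (cases "C \<in> faces i")
    case True
    have "from_multidegrees D (\<lambda>C a. bd (\<lambda>B. c B a) C) C = mdiff g C"
      using mdiff_cong[OF C, of g "from_multidegrees D c"] D mdiff_from_multidegrees[OF D(2)]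
          by simp
    then show ?thesis
      using from_multidegrees_eq_0D[OF D(1) divisible_bd[OF D(2)] _ a] dg[OF True] by simp
  next
    case False
    have "c (insert x C) a = 0" if x: "x \<in> V - C" for x
    proof (rule ccontr)
      assume "c (insert x C) a \<noteq> 0"
      from c_face[OF this] show False
        using False x finite_subset[OF C finite_V] face_down[of "insert x C" C]
        by (auto simp: faces_def)
    qed
    then show ?thesis
      by (simp add: bd_def)
  qed
  \<comment> \<open>Multidegrees divisible by an edge monomial have an apex; in all others no
    nonempty face contributes and \<open>c\<close> vanishes.\<close>
  let ?cov = "\<lambda>a :: 'v \<Rightarrow>\<^sub>0 nat. \<exists>E\<in>V. E \<subseteq> Poly_Mapping.keys a"
  have "\<forall>a. \<exists>p. ?cov a \<longrightarrow> p \<in> V \<and> p \<subseteq> Poly_Mapping.keys a \<and>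
      (\<forall>A\<in>\<Delta>. \<Union>A \<subseteq> Poly_Mapping.keys a \<longrightarrow> insert p A \<in> \<Delta>)"
  proof
    fix a
    show "\<exists>p. ?cov a \<longrightarrow> p \<in> V \<and> p \<subseteq> Poly_Mapping.keys a \<and>
      (\<forall>A\<in>\<Delta>. \<Union>A \<subseteq> Poly_Mapping.keys a \<longrightarrow> insert p A \<in> \<Delta>)"
    proof (cases "?cov a")
      case True
      then obtain E where "E \<in> V" "E \<subseteq> Poly_Mapping.keys a"
        by blast
      from apex_exists[OF this] show ?thesis
        by blast
    qed blast
  qed
  from choice[OF this] obtain p where p': "\<forall>a. ?cov a \<longrightarrow> p a \<in> V \<and> p a \<subseteq> Poly_Mapping.keys a \<and>
      (\<forall>A\<in>\<Delta>. \<Union>A \<subseteq> Poly_Mapping.keys a \<longrightarrow> insert (p a) A \<in> \<Delta>)"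
    by (rule exE)
  have p: "p a \<in> V" "p a \<subseteq> Poly_Mapping.keys a"
      "\<And>A. A \<in> \<Delta> \<Longrightarrow> \<Union>A \<subseteq> Poly_Mapping.keys a \<Longrightarrow> insert (p a) A \<in> \<Delta>" if "?cov a" for a
    using spec[OF p', of a] that by simp_all
  \<comment> \<open>The preimage is the cone over \<open>c\<close>, with an apex depending on the
    multidegree. As the boundary of \<open>c\<close> vanishes, \<open>bd_cone\<close> returns
    \<open>c\<close>.\<close>
  define w :: "'v set set \<Rightarrow> ('v \<Rightarrow>\<^sub>0 nat) \<Rightarrow> 'b" where "w C a =
      (if ?cov a then cone (p a) (\<lambda>B. c B a) C else 0)" for C a
  have w: "C \<in> faces (Suc (Suc i)) \<and> \<Union>C \<subseteq> Poly_Mapping.keys a" if "w C a \<noteq> 0" for C a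
  proof -
    have *: "?cov a" "p a \<in> C" "c (C - {p a}) a \<noteq> 0"
      using that by (auto simp: w_def cone_def split: if_splits)
    have f: "C - {p a} \<in> \<Delta>" "card (C - {p a}) = Suc i" "\<Union>(C - {p a}) \<subseteq> Poly_Mapping.keys a"
      using c_face[OF *(3)] D(2) *(3) by (auto simp: faces_def divisible_def)
    have C: "insert (p a) (C - {p a}) = C"
      using *(2) by blast
    have "C \<in> \<Delta>"
      using p(3)[OF *(1) f(1,3)] by (simp only: C)
    moreover have "\<Union>C \<subseteq> Poly_Mapping.keys a"
      using p(2)[OF *(1)] f(3) by blast
    moreover have "card C = Suc (Suc i)"
      using f(2) *(2) by simp
    ultimately show ?thesis
      by (simp add: faces_def)
  qed
  then have w_div: "divisible w"
    by (auto simp: divisible_def)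
  have bdw: "bd (\<lambda>B. w B a) C = c C a" if C: "C \<subseteq> V" and a: "a \<in> D" for C a
  proof (cases "?cov a")
    case True
    have "cone (p a) (bd (\<lambda>B. c B a)) C = 0"
      using bd0[of "C - {p a}" a] C a by (auto simp: cone_def)
    then show ?thesis
      using bd_cone[OF C p(1)[OF True], of "\<lambda>B. c B a"] True by (simp add: w_def)
  next
    case False
    \<comment> \<open>Faces of size \<open>Suc i\<close> are nonempty, so one that contributed here
      would contain an edge inside the support of \<open>a\<close>.\<close>
    have "c C a = 0"
    proof (rule ccontr)
      assume *: "c C a \<noteq> 0"
      then obtain E where "E \<in> C"
        using c_face[OF *] by (auto simp: faces_def dest!: card_eq_SucD)
      moreover have "\<Union>C \<subseteq> Poly_Mapping.keys a"
        using * D(2) by (auto simp: divisible_def)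
      ultimately show False
        using False C by blast
    qed
    then show ?thesis
      using False by (simp add: w_def bd_def)
  qed
  show ?thesis
  proof (rule that[of "from_multidegrees D w"])
    show "supported (Suc (Suc i)) (from_multidegrees D w)"
      unfolding supported_def from_multidegrees_def
      by (metis (no_types, lifting) w single_zero sum.neutral)
    show "mdiff (from_multidegrees D w) C = g C" if C: "C \<subseteq> V" for C
    proof -
      have "mdiff (from_multidegrees D w) C = from_multidegrees D c C"
        unfolding mdiff_from_multidegrees[OF w_div]
        by (simp add: from_multidegrees_def bdw[OF C])
      then show ?thesis
        using D(3)[OF C] by simp
    qed
  qed
qed

section \<open>From functions on faces to coordinate vectors\<close>

lemma finite_faces: "finite (faces i)"
  by (rule finite_subset[of _ "Pow V"]) (auto simp: faces_def finite_V dest: face_subset)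

definition face :: "nat \<Rightarrow> nat \<Rightarrow> 'v set set" where
  "face i = (SOME f. bij_betw f {..<card (faces i)} (faces i))"

lemma bij_betw_face: "bij_betw (face i) {..<card (faces i)} (faces i)"
  unfolding face_def using ex_bij_betw_nat_finite[OF finite_faces]
  by (intro someI_ex[of "\<lambda>f. bij_betw f {..<card (faces i)} (faces i)"]) (simp add: lessThan_atLeast0)

lemma face_mem: "b < card (faces i) \<Longrightarrow> face i b \<in> faces i"
  using bij_betw_face[of i] by (auto simp: bij_betw_def)

lemma face_surj:
  assumes "C \<in> faces i"
  obtains b where "b < card (faces i)" "face i b = C"
  using assms bij_betw_face[of i] by (metis bij_betw_imp_surj_on imageE lessThan_iff)

text \<open>In \<open>taylor\<close> the faces have sizes \<open>i\<close> and \<open>Suc i\<close>;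
  inclusion then leaves a single vertex for \<open>the_elem\<close> to pick.\<close>

definition entry :: "'v set set \<Rightarrow> 'v set set \<Rightarrow> ('v, 'k::field) mpoly" where
  "entry C B = (if C \<subseteq> B then sgn_at (the_elem (B - C)) C * sqfree_monom (\<Union>B - \<Union>C) else 0)"

definition taylor :: "('v, 'k::field) mpoly set \<Rightarrow>
    (('v, 'k) mpoly, ('v, 'k) mpoly set) free_complex" where
  "taylor I = \<lparr>rank = (\<lambda>i. card (faces i)),
     basis_deg = (\<lambda>i b. int (card (\<Union>(face i b)))),
     differential = (\<lambda>i a b. entry (face i a) (face (Suc i) b)),
     augmentation = (\<lambda>b. I +>\<^bsub>poly_ring\<^esub> 1)\<rparr>"

definition to_vec :: "nat \<Rightarrow> ('v set set \<Rightarrow> ('v, 'k::field) mpoly) \<Rightarrow> nat \<Rightarrow> ('v, 'k) mpoly" where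
  "to_vec i g b = (if b < card (faces i) then g (face i b) else 0)"

definition of_vec :: "nat \<Rightarrow> (nat \<Rightarrow> ('v, 'k::field) mpoly) \<Rightarrow> 'v set set \<Rightarrow> ('v, 'k) mpoly" where
  "of_vec i v C = (if C \<in> faces i then v (inv_into {..<card (faces i)} (face i) C) else 0)"

lemma supported_of_vec: "supported i (of_vec i v)"
  by (simp add: supported_def of_vec_def)

lemma to_vec_free: "to_vec i g \<in> free_module (rank (taylor I) i)"
  by (simp add: to_vec_def free_module_def taylor_def)

lemma of_vec_face: "b < card (faces i) \<Longrightarrow> of_vec i v (face i b) = v b"
  using bij_betw_face[of i] face_mem by (simp add: of_vec_def bij_betw_def)

lemma to_vec_of_vec: "v \<in> free_module (rank (taylor I) i) \<Longrightarrow> to_vec i (of_vec i v) = v"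
  by (auto simp: to_vec_def of_vec_face free_module_def taylor_def fun_eq_iff)

lemma of_vec_to_vec:
  assumes "supported i g"
  shows "of_vec i (to_vec i g) = g"
proof
  fix C
  show "of_vec i (to_vec i g) C = g C"
  proof (cases "C \<in> faces i")
    case True
    then obtain b where "b < card (faces i)" "face i b = C"
      by (rule face_surj)
    then show ?thesis
      using of_vec_face[of b i "to_vec i g"] by (simp add: to_vec_def)
  next
    case False
    then show ?thesis
      using assms by (auto simp: of_vec_def supported_def)
  qed
qed

text \<open>The differently indexed sums agree: a face not of the form \<open>insert x C\<close> has
  entry 0, and a set \<open>insert x C\<close> that is no face lies outside the support of
  \<open>g\<close>.\<close>

lemma mdiff_eq_sum_entry:
  assumes C: "C \<in> faces i" and g: "supported (Suc i) g"
  shows "mdiff g C = (\<Sum>B\<in>faces (Suc i). entry C B * g B)"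
proof -
  have fin: "finite C"
    using C finite_subset[OF face_subset finite_V] by (auto simp: faces_def)
  have "mdiff g C = (\<Sum>x\<in>V - C. entry C (insert x C) * g (insert x C))"
    unfolding mdiff_def
  proof (rule sum.cong[OF refl])
    fix x assume "x \<in> V - C"
    then have "insert x C - C = {x}"
      by auto
    then show "sgn_at x C * sqfree_monom (\<Union>(insert x C) - \<Union>C) * g (insert x C) =
        entry C (insert x C) * g (insert x C)"
      by (simp add: entry_def subset_insertI)
  qed
  also have "\<dots> = (\<Sum>B\<in>(\<lambda>x. insert x C) ` (V - C). entry C B * g B)"
    by (subst sum.reindex) (auto simp: inj_on_def)
  also have "\<dots> = (\<Sum>B\<in>faces (Suc i). entry C B * g B)"
  proof (rule sum.mono_neutral_cong)
    fix B assume B: "B \<in> faces (Suc i) - (\<lambda>x. insert x C) ` (V - C)"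
    have "\<not> C \<subseteq> B"
    proof
      assume sub: "C \<subseteq> B"
      then have "card (B - C) = Suc 0"
        using B C fin by (simp add: card_Diff_subset faces_def)
      then obtain x where "B - C = {x}"
        by (auto simp: card_Suc_eq)
      then have "B = insert x C" "x \<in> V - C"
        using sub B face_subset[of B] by (auto simp: faces_def)
      then show False
        using B by blast
    qed
    then show "entry C B * g B = 0"
      by (simp add: entry_def)
  next
    fix B assume "B \<in> (\<lambda>x. insert x C) ` (V - C) - faces (Suc i)"
    then have "g B = 0"
      using g by (auto simp: supported_def)
    then show "entry C B * g B = 0"
      by simp
  qed (auto simp: finite_V finite_faces)
  finally show ?thesis .
qed

lemma diff_map_taylor:
  assumes "v \<in> free_module (rank (taylor I) (Suc i))"
  shows "diff_map (taylor I) i v = to_vec i (mdiff (of_vec (Suc i) v))"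
proof
  fix a
  show "diff_map (taylor I) i v a = to_vec i (mdiff (of_vec (Suc i) v)) a"
  proof (cases "a < card (faces i)")
    case True
    have "diff_map (taylor I) i v a =
        (\<Sum>b<card (faces (Suc i)). entry (face i a) (face (Suc i) b) * of_vec (Suc i) v (face (Suc i) b))"
      using True by (simp add: diff_map_def taylor_def of_vec_face)
    also have "\<dots> = (\<Sum>B\<in>faces (Suc i). entry (face i a) B * of_vec (Suc i) v B)"
      by (rule sum.reindex_bij_betw[OF bij_betw_face])
    also have "\<dots> = mdiff (of_vec (Suc i) v) (face i a)"
      by (rule mdiff_eq_sum_entry[OF face_mem[OF True] supported_of_vec, symmetric])
    finally show ?thesis
      using True by (simp add: to_vec_def)
  qed (simp add: diff_map_def taylor_def to_vec_def)
qed

text \<open>Closure of \<open>\<Delta>\<close> under subsets makes the restriction a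
  subcomplex.\<close>

lemma supported_mdiff:
  assumes "supported (Suc i) g" "mdiff g C \<noteq> 0"
  shows "C \<in> faces i"
proof -
  obtain x where x: "x \<in> V - C" "g (insert x C) \<noteq> 0"
    using assms(2) unfolding mdiff_def by (metis (no_types, lifting) mult_zero_right sum.neutral)
  then have "insert x C \<in> faces (Suc i)"
    using assms(1) by (simp add: supported_def)
  moreover from this have "finite C"
    using finite_subset[OF face_subset finite_V] by (auto simp: faces_def)
  ultimately show ?thesis
    using x face_down[of "insert x C" C] by (auto simp: faces_def)
qed

text \<open>\<open>mdiff_exact\<close> and \<open>mdiff_mdiff\<close>, carried over to coordinate
  vectors.\<close>

lemma taylor_exact:
  "{v \<in> free_module (rank (taylor I) (Suc i)). diff_map (taylor I) i v = (\<lambda>_. 0)} =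
     diff_map (taylor I) (Suc i) ` free_module (rank (taylor I) (Suc (Suc i)))"
proof (intro subset_antisym subsetI)
  fix v assume "v \<in> {v \<in> free_module (rank (taylor I) (Suc i)). diff_map (taylor I) i v = (\<lambda>_. 0)}"
  then have v: "v \<in> free_module (rank (taylor I) (Suc i))"
      and 0: "to_vec i (mdiff (of_vec (Suc i) v)) = (\<lambda>_. 0)"
    by (auto simp: diff_map_taylor)
  have "mdiff (of_vec (Suc i) v) C = 0" if C: "C \<in> faces i" for C
  proof -
    obtain b where "b < card (faces i)" "face i b = C"
      by (rule face_surj[OF C])
    then show ?thesis
      using fun_cong[OF 0, of b] by (simp add: to_vec_def)
  qed
  then obtain h where h: "supported (Suc (Suc i)) h" "\<And>C. C \<subseteq> V \<Longrightarrow> mdiff h C = of_vec (Suc i) v C"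
    using mdiff_exact[OF supported_of_vec] by metis
  have "diff_map (taylor I) (Suc i) (to_vec (Suc (Suc i)) h) = to_vec (Suc i) (mdiff h)"
    by (simp add: diff_map_taylor to_vec_free of_vec_to_vec h(1))
  also have "\<dots> = to_vec (Suc i) (of_vec (Suc i) v)"
    using face_mem h(2) face_subset by (auto simp: to_vec_def fun_eq_iff faces_def)
  also have "\<dots> = v"
    by (rule to_vec_of_vec[OF v])
  finally show "v \<in> diff_map (taylor I) (Suc i) ` free_module (rank (taylor I) (Suc (Suc i)))"
    by (metis imageI to_vec_free)
next
  fix v assume "v \<in> diff_map (taylor I) (Suc i) ` free_module (rank (taylor I) (Suc (Suc i)))"
  then obtain u where u: "u \<in> free_module (rank (taylor I) (Suc (Suc i)))"
    "v = to_vec (Suc i) (mdiff (of_vec (Suc (Suc i)) u))"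
    by (auto simp: diff_map_taylor)
  have "of_vec (Suc i) v = mdiff (of_vec (Suc (Suc i)) u)"
    unfolding u(2) by (rule of_vec_to_vec)
        (auto simp: supported_def intro: supported_mdiff supported_of_vec)
  then have "diff_map (taylor I) i v = to_vec i (mdiff (mdiff (of_vec (Suc (Suc i)) u)))"
    using diff_map_taylor[of v I i] by (simp add: u(2) to_vec_free)
  also have "\<dots> = (\<lambda>_. 0)"
    using face_mem face_subset by (auto simp: to_vec_def fun_eq_iff faces_def mdiff_mdiff)
  finally show "v \<in> {v \<in> free_module (rank (taylor I) (Suc i)). diff_map (taylor I) i v = (\<lambda>_. 0)}"
    by (simp add: u(2) to_vec_free)
qed

lemma homogeneous_entry:
  assumes "C \<subseteq> V"
  shows "homogeneous (int (card (\<Union>B)) - int (card (\<Union>C))) (entry C B)"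
proof (cases "C \<subseteq> B")
  case True
  then have "int (card (\<Union>B)) - int (card (\<Union>C)) = int (card (\<Union>B - \<Union>C))"
    by (simp add: card_Diff_subset Union_mono card_mono of_nat_diff)
  then show ?thesis
    using True homogeneous_single[of "ind (\<Union>B - \<Union>C)"]
    by (simp add: entry_def sqfree_monom_def sgn_at_single total_degree_ind)
qed (simp add: entry_def)

lemma rank_taylor_0: "rank (taylor I) 0 = 1" and face_0: "face 0 0 = {}"
proof -
  have *: "faces 0 = {{}}"
    using empty_face finite_subset[OF face_subset finite_V] by (auto simp: faces_def)
  then show "rank (taylor I) 0 = 1" "face 0 0 = {}"
    using face_mem[of 0 0] by (auto simp: taylor_def)
qed

text \<open>The basis element of the face \<open>{x}\<close> goes to the monomial of the edge
  \<open>x\<close> with sign 1, so the image of the first differential will be the edge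
  ideal.\<close>

lemma diff_map_taylor_0:
  assumes "v \<in> free_module (rank (taylor I) (Suc 0))"
  shows "diff_map (taylor I) 0 v 0 = (\<Sum>x\<in>V. sqfree_monom x * of_vec (Suc 0) v {x})"
proof -
  have "card (faces 0) = 1"
    using rank_taylor_0[of I] by (simp add: taylor_def)
  then show ?thesis
    by (simp add: diff_map_taylor[OF assms] to_vec_def face_0 mdiff_def sgn_at_def)
qed

end

section \<open>Resolutions of the edge ideal\<close>

context homogeneous_ideal
begin

lemma ideal_poly_ring: "ideal I poly_ring"
proof (rule idealI)
  show "ring (poly_ring :: ('v, 'k) mpoly ring)"
    by (rule ring_from_type_algebra)
  then interpret ring "poly_ring :: ('v, 'k) mpoly ring" .
  have "\<ominus>\<^bsub>poly_ring\<^esub> p = - p" for p :: "('v, 'k) mpoly"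
    by (rule minus_equality) (simp_all add: ring_of_type_algebra_def)
  then show "subgroup I (add_monoid poly_ring)"
    using diff_mem[OF zero_mem]
    by unfold_locales (auto simp: ring_of_type_algebra_def zero_mem add_mem a_inv_def)
  show "\<And>a x. a \<in> I \<Longrightarrow> x \<in> carrier poly_ring \<Longrightarrow> x \<otimes>\<^bsub>poly_ring\<^esub> a \<in> I"
    by (simp add: ring_of_type_algebra_def mult_mem)
  show "a \<otimes>\<^bsub>poly_ring\<^esub> x \<in> I" if "a \<in> I" for a x
    using mult_mem[OF that, of x] by (simp add: ring_of_type_algebra_def mult.commute)
qed

sublocale poly_ideal: ideal I poly_ring
  by (rule ideal_poly_ring)

abbreviation coset :: "('v, 'k) mpoly \<Rightarrow> ('v, 'k) mpoly set" where
  "coset p \<equiv> I +>\<^bsub>poly_ring\<^esub> p"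

lemma coset_eq_iff: "coset p = coset q \<longleftrightarrow> p - q \<in> I"
proof
  assume "coset p = coset q"
  moreover have "p \<in> coset p"
    using zero_mem by (auto simp: a_r_coset_def' ring_of_type_algebra_def)
  ultimately obtain r where "r \<in> I" "p = r + q"
    by (auto simp: a_r_coset_def' ring_of_type_algebra_def)
  then show "p - q \<in> I"
    by simp
next
  assume *: "p - q \<in> I"
  have "r + p \<in> (\<lambda>r. r + q) ` I" if "r \<in> I" for r
    using add_mem[OF that *] by (auto simp: image_iff intro!: bexI[of _ "r + (p - q)"])
  moreover have "r + q \<in> (\<lambda>r. r + p) ` I" if "r \<in> I" for r
    using diff_mem[OF that *] by (auto simp: image_iff intro!: bexI[of _ "r - (p - q)"])
  ultimately show "coset p = coset q"
    by (auto simp: a_r_coset_def' ring_of_type_algebra_def)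
qed

lemma coset_zero: "coset 0 = I"
  by (auto simp: a_r_coset_def' ring_of_type_algebra_def)

lemma coset_eq_zero_iff: "coset p = \<zero>\<^bsub>quotient_module I\<^esub> \<longleftrightarrow> p \<in> I"
  using coset_eq_iff[of p 0] by (simp add: coset_zero quotient_module_def FactRing_def)

lemma carrier_quotient_module: "carrier (quotient_module I) = range coset"
  by (auto simp: quotient_module_def FactRing_def A_RCOSETS_def' ring_of_type_algebra_def)

lemma smult_coset: "r \<odot>\<^bsub>quotient_module I\<^esub> coset p = coset (r * p)"
  using poly_ideal.rcoset_mult_add[of r p]
  by (simp add: quotient_module_def FactRing_def ring_of_type_algebra_def)

lemma grade_quotient_module: "grade (quotient_module I) j = coset ` {p. homogeneous j p}"
  by (auto simp: quotient_module_def)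

lemma aug_map_quotient_module:
  assumes "\<And>b. b < rank F 0 \<Longrightarrow> augmentation F b = coset (f b)"
  shows "aug_map (quotient_module I) F v = coset (comb (rank F 0) f v)"
proof -
  interpret Q: ring "poly_ring Quot I"
    by (rule poly_ideal.quotient_is_ring)
  have add: "coset p \<oplus>\<^bsub>poly_ring Quot I\<^esub> coset q = coset (p + q)" for p q
    using poly_ideal.a_rcos_sum[of p q] by (simp add: FactRing_def ring_of_type_algebra_def)
  have carr: "coset p \<in> carrier (poly_ring Quot I)" for p
    using carrier_quotient_module by (simp add: quotient_module_def)
  have "finsum (poly_ring Quot I) (\<lambda>b. coset (v b * f b)) {..<n} = coset (\<Sum>b<n. v b * f b)" for n
  proof (induction n)
    case 0
    then show ?case
      using coset_eq_zero_iff[of 0] zero_mem by (simp add: coset_zero quotient_module_def)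
  next
    case (Suc n)
    then show ?case
      by (simp add: lessThan_Suc Q.finsum_insert carr add)
  qed
  \<comment> \<open>\<open>quotient_module I\<close> copies the addition of the quotient ring, so
    the sum can be evaluated there, where the ring lemmas apply.\<close>
  moreover have "aug_map (quotient_module I) F v =
      finsum (poly_ring Quot I) (\<lambda>b. v b \<odot>\<^bsub>quotient_module I\<^esub> augmentation F b) {..<rank F 0}"
    by (simp add: aug_map_def finsum_def finprod_def quotient_module_def)
  moreover have "\<dots> = finsum (poly_ring Quot I) (\<lambda>b. coset (v b * f b)) {..<rank F 0}"
    by (rule Q.finsum_cong') (simp_all add: assms smult_coset carr)
  ultimately show ?thesis
    by (simp add: comb_def)
qed

text \<open>Homogeneous representatives of the images of the basis elements exist because the graded
  pieces of R/I are the images of those of R.\<close>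

lemma resolves_of_resolution:
  assumes F: "graded_free_resolution (quotient_module I) F"
  obtains f where "resolves f F"
proof -
  have "\<forall>b. \<exists>p. b < rank F 0 \<longrightarrow> homogeneous (basis_deg F 0 b) p \<and> augmentation F b = coset p"
    using F by (auto simp: graded_free_resolution_def grade_quotient_module)
  then obtain f where f: "\<And>b. b < rank F 0 \<Longrightarrow> homogeneous (basis_deg F 0 b) (f b)"
    "\<And>b. b < rank F 0 \<Longrightarrow> augmentation F b = coset (f b)"
    by metis
  note aug = aug_map_quotient_module[OF f(2)]
  have "\<exists>v\<in>free_module (rank F 0). comb (rank F 0) f v - g \<in> I" for g
  proof -
    have "coset g \<in> aug_map (quotient_module I) F ` free_module (rank F 0)"
      using F by (auto simp: graded_free_resolution_def carrier_quotient_module)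
    then obtain v where "v \<in> free_module (rank F 0)" "coset (comb (rank F 0) f v) = coset g"
      by (auto simp: aug)
    then show ?thesis
      by (auto simp: coset_eq_iff)
  qed
  moreover have "syz f F i = diff_map F i ` free_module (rank F (Suc i))" for i
  proof (cases i)
    case 0
    have "{v \<in> free_module (rank F 0). aug_map (quotient_module I) F v = \<zero>\<^bsub>quotient_module I\<^esub>} =
       diff_map F 0 ` free_module (rank F 1)"
      using F by (simp add: graded_free_resolution_def)
    then show ?thesis
      by (simp add: 0 syz_def aug coset_eq_zero_iff)
  next
    case (Suc i')
    then show ?thesis
      using F by (simp add: graded_free_resolution_def syz_def)
  qed
  ultimately have "resolves f F"
    using F f(1) by (simp add: resolves_def graded_free_resolution_def)
  then show ?thesis
    by (rule that)
qed

lemma reg_quotient_module_le: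
  fixes G :: "(('v, 'k) mpoly, ('v, 'k) mpoly set) free_complex"
  assumes G: "graded_free_resolution (quotient_module I) G"
    and deg: "\<And>i b. b < rank G i \<Longrightarrow> real_of_int (basis_deg G i b) \<le> real i + r"
  shows "reg (quotient_module I) \<le> ereal r"
proof -
  define F where "F = (SOME F. graded_free_resolution (quotient_module I) F)"
  \<comment> \<open>The existence of \<open>G\<close> guarantees that \<open>SOME\<close> picks a
    resolution.\<close>
  have "graded_free_resolution (quotient_module I) F"
    unfolding F_def by (rule someI[of _ G]) (rule G)
  then obtain f where f: "resolves f F"
    by (rule resolves_of_resolution)
  obtain g where g: "resolves g G"
    using G by (rule resolves_of_resolution)
  have le: "real_of_int j \<le> real i + r"
    if "carrier (Tor_k (quotient_module I) i j) \<noteq> {\<one>\<^bsub>Tor_k (quotient_module I) i j\<^esub>}" for i j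
  proof (rule ccontr)
    assume "\<not> real_of_int j \<le> real i + r"
    then have "basis_deg G i b \<noteq> j" if "b < rank G i" for b
      using deg[OF that] by auto
    then show False
      using homology_k_trivial_of_resolution[OF f g, of i j] that by (simp add: Tor_k_def F_def)
  qed
  show ?thesis
    unfolding reg_def
  proof (rule SUP_least)
    fix i :: nat
    let ?J = "{j. carrier (Tor_k (quotient_module I) i j) \<noteq> {\<one>\<^bsub>Tor_k (quotient_module I) i j\<^esub>}}"
    \<comment> \<open>This covers an empty \<open>?J\<close> as well, where the supremum is
      -\<infinity>.\<close>
    have "(SUP j\<in>?J. ereal (real_of_int j)) \<le> ereal (real i + r)"
      by (rule SUP_least) (simp add: le)
    then have "(SUP j\<in>?J. ereal (real_of_int j)) - ereal (real i) \<le> ereal (real i + r) - ereal (real i)"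
      by (rule ereal_minus_mono) simp
    then show "(SUP j\<in>?J. ereal (real_of_int j)) - ereal (real i) \<le> ereal r"
      by simp
  qed
qed

end

lemma homogeneous_ideal_monomial_combinations:
  "homogeneous_ideal {\<Sum>E\<in>\<E>. sqfree_monom E * q E :: ('v::finite, 'k::field) mpoly | q. True}"
  (is "homogeneous_ideal ?J")
proof
  show "0 \<in> ?J"
    by (auto intro!: exI[of _ "\<lambda>_. 0"])
next
  fix p q assume "p \<in> ?J" "q \<in> ?J"
  then obtain p' q' where "p = (\<Sum>E\<in>\<E>. sqfree_monom E * p' E)" "q = (\<Sum>E\<in>\<E>. sqfree_monom E * q' E)"
    by blast
  then show "p + q \<in> ?J"
    by (auto intro!: exI[of _ "\<lambda>E. p' E + q' E"] simp: algebra_simps sum.distrib)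
next
  fix p r assume "p \<in> ?J"
  then obtain p' where "p = (\<Sum>E\<in>\<E>. sqfree_monom E * p' E)"
    by blast
  then show "r * p \<in> ?J"
    by (auto intro!: exI[of _ "\<lambda>E. r * p' E"] simp: algebra_simps sum_distrib_left)
next
  fix p j assume "p \<in> ?J"
  then obtain p' where "p = (\<Sum>E\<in>\<E>. sqfree_monom E * p' E)"
    by blast
  then have "hom_part j p = (\<Sum>E\<in>\<E>. sqfree_monom E * hom_part (j - int (card E)) (p' E))"
    by (simp add: hom_part_sum hom_part_mult_left[OF homogeneous_sqfree_monom])
  then show "hom_part j p \<in> ?J"
    by (intro CollectI exI conjI TrueI)
qed

text \<open>This form of membership is the one that \<open>diff_map_taylor_0\<close> produces. The
  right side is an ideal containing the generators, and every ideal containing them contains these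
  sums.\<close>

lemma edge_ideal_eq:
  "(edge_ideal \<E> :: ('v::finite, 'k::field) mpoly set) = {\<Sum>E\<in>\<E>. sqfree_monom E * q E | q. True}"
  (is "_ = ?J")
proof (rule subset_antisym)
  interpret R: ring "poly_ring :: ('v, 'k) mpoly ring"
    by (rule ring_from_type_algebra)
  have gens: "{\<Prod>x\<in>E. var x | E. E \<in> \<E>} = (sqfree_monom ` \<E> :: ('v, 'k) mpoly set)"
    by (auto simp: prod_var)
  have "ideal ?J poly_ring"
    by (rule homogeneous_ideal.ideal_poly_ring[OF homogeneous_ideal_monomial_combinations])
  moreover have "sqfree_monom E \<in> ?J" if "E \<in> \<E>" for E
    using that by (auto intro!: exI[of _ "\<lambda>E'. if E' = E then 1 else 0"]
        simp: if_distrib cong: if_cong)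
  ultimately show "edge_ideal \<E> \<subseteq> ?J"
    unfolding edge_ideal_def gens by (intro R.genideal_minimal) auto
  interpret I: ideal "edge_ideal \<E> :: ('v, 'k) mpoly set" poly_ring
    unfolding edge_ideal_def by (intro R.genideal_ideal) (simp add: ring_of_type_algebra_def)
  have mult: "sqfree_monom E * q \<in> edge_ideal \<E>" if "E \<in> \<E>" for E and q :: "('v, 'k) mpoly"
  proof -
    have "sqfree_monom E \<in> (edge_ideal \<E> :: ('v, 'k) mpoly set)"
      using that R.genideal_self[of "sqfree_monom ` \<E>"]
      unfolding edge_ideal_def gens by (auto simp: ring_of_type_algebra_def)
    then show ?thesis
      using I.I_r_closed[of "sqfree_monom E" q] by (simp add: ring_of_type_algebra_def)
  qed
  have zero: "0 \<in> (edge_ideal \<E> :: ('v, 'k) mpoly set)"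
    using I.zero_closed by (simp add: ring_of_type_algebra_def)
  have add: "p + q \<in> edge_ideal \<E>" if "p \<in> edge_ideal \<E>" "q \<in> edge_ideal \<E>"
      for p q :: "('v, 'k) mpoly"
    using I.a_closed[OF that] by (simp add: ring_of_type_algebra_def)
  have "(\<Sum>E\<in>A. sqfree_monom E * q E) \<in> edge_ideal \<E>" if "finite A" "A \<subseteq> \<E>"
    for A and q :: "'v set \<Rightarrow> ('v, 'k) mpoly"
    using that by (induction A rule: finite_induct) (simp_all add: mult zero add)
  then show "?J \<subseteq> edge_ideal \<E>"
    by auto
qed

lemma homogeneous_ideal_edge_ideal:
  "homogeneous_ideal (edge_ideal \<E> :: ('v::finite, 'k::field) mpoly set)"
  unfolding edge_ideal_eq by (rule homogeneous_ideal_monomial_combinations)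

context conical_complex
begin

lemma taylor_resolution:
  "graded_free_resolution (quotient_module (edge_ideal V)) (taylor (edge_ideal V :: ('v, 'k::field) mpoly set))"
proof -
  let ?I = "edge_ideal V :: ('v, 'k) mpoly set"
  let ?M = "quotient_module ?I" and ?G = "taylor ?I"
  interpret homogeneous_ideal ?I
    by (rule homogeneous_ideal_edge_ideal)
  have aug: "aug_map ?M ?G v = coset (v 0)" for v
  proof -
    have "augmentation ?G b = coset 1" for b
      by (simp add: taylor_def)
    then show ?thesis
      using aug_map_quotient_module[of ?G "\<lambda>_. 1" v] by (simp add: comb_def rank_taylor_0)
  qed
  have hom: "\<forall>i. \<forall>a<rank ?G i. \<forall>b<rank ?G (Suc i).
      homogeneous (basis_deg ?G (Suc i) b - basis_deg ?G i a) (differential ?G i a b)"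
    using face_mem face_subset by (auto simp: taylor_def faces_def intro!: homogeneous_entry)
  have grade0: "\<forall>b<rank ?G 0. augmentation ?G b \<in> grade ?M (basis_deg ?G 0 b)"
    by (auto simp: rank_taylor_0 grade_quotient_module) (simp add: taylor_def face_0)
  have surj: "aug_map ?M ?G ` free_module (rank ?G 0) = carrier ?M"
  proof -
    have "coset p \<in> aug_map ?M ?G ` free_module (rank ?G 0)" for p
      by (rule image_eqI[of _ _ "\<lambda>b. if b = 0 then p else 0"])
        (simp_all add: aug free_module_def rank_taylor_0)
    then show ?thesis
      by (auto simp: carrier_quotient_module aug)
  qed
  have ker: "{v \<in> free_module (rank ?G 0). aug_map ?M ?G v = \<zero>\<^bsub>?M\<^esub>} =
      diff_map ?G 0 ` free_module (rank ?G 1)"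
  proof (intro subset_antisym subsetI)
    fix v assume "v \<in> {v \<in> free_module (rank ?G 0). aug_map ?M ?G v = \<zero>\<^bsub>?M\<^esub>}"
    then have v: "v \<in> free_module 1" "v 0 \<in> ?I"
      by (auto simp: aug coset_eq_zero_iff rank_taylor_0)
    then obtain q where q: "v 0 = (\<Sum>E\<in>V. sqfree_monom E * q E)"
      by (auto simp: edge_ideal_eq)
    \<comment> \<open>The preimage of \<open>v\<close> puts the coefficient of the generator
      \<open>E\<close> on the face \<open>{E}\<close>.\<close>
    define g where "g C = (if C \<in> faces (Suc 0) then q (the_elem C) else 0)" for C
    have "supported (Suc 0) g"
      by (simp add: supported_def g_def)
    then have "diff_map ?G 0 (to_vec (Suc 0) g) 0 = (\<Sum>E\<in>V. sqfree_monom E * g {E})"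
      by (simp add: diff_map_taylor_0 to_vec_free of_vec_to_vec)
    also have "\<dots> = v 0"
      unfolding q using vertex_face by (intro sum.cong) (auto simp: g_def faces_def)
    finally have 0: "diff_map ?G 0 (to_vec (Suc 0) g) 0 = v 0" .
    have "diff_map ?G 0 (to_vec (Suc 0) g) b = v b" for b
    proof (cases b)
      case (Suc b')
      then show ?thesis
        using v(1) diff_map_free[of ?G 0 "to_vec (Suc 0) g"]
            by (simp add: free_module_def rank_taylor_0)
    qed (simp add: 0)
    then have "diff_map ?G 0 (to_vec (Suc 0) g) = v"
      by (rule ext)
    then show "v \<in> diff_map ?G 0 ` free_module (rank ?G 1)"
      using to_vec_free[of "Suc 0" g ?I] by auto
  next
    fix v assume "v \<in> diff_map ?G 0 ` free_module (rank ?G 1)"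
    then obtain u where u: "u \<in> free_module (rank ?G (Suc 0))" "v = diff_map ?G 0 u"
      by auto
    have "v 0 \<in> ?I"
      unfolding u(2) diff_map_taylor_0[OF u(1)] by (subst edge_ideal_eq)
        (intro CollectI exI[of _ "\<lambda>E. of_vec (Suc 0) u {E}"] conjI TrueI refl)
    then show "v \<in> {v \<in> free_module (rank ?G 0). aug_map ?M ?G v = \<zero>\<^bsub>?M\<^esub>}"
      by (simp add: aug coset_eq_zero_iff u(2) diff_map_free)
  qed
  show ?thesis
    unfolding graded_free_resolution_def
        by (intro conjI grade0 hom surj ker) (rule allI, rule taylor_exact)
qed

lemma reg_edge_ideal_le:
  assumes "\<And>A. A \<in> \<Delta> \<Longrightarrow> real (card (\<Union>A)) \<le> real (card A) + r"
  shows "reg (quotient_module (edge_ideal V :: ('v, 'k::field) mpoly set)) \<le> ereal r"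
proof (rule homogeneous_ideal.reg_quotient_module_le[OF homogeneous_ideal_edge_ideal taylor_resolution])
  fix i b assume "b < rank (taylor (edge_ideal V :: ('v, 'k) mpoly set)) i"
  then have "face i b \<in> faces i"
    by (simp add: taylor_def face_mem)
  then show "real_of_int (basis_deg (taylor (edge_ideal V :: ('v, 'k) mpoly set)) i b) \<le> real i + r"
    using assms[of "face i b"] by (simp add: taylor_def faces_def)
qed

end

section \<open>The simplicial complex of a 2-collage\<close>

locale collage =
  fixes V C :: "'v::finite set set" and d :: nat and \<phi> :: "'v set \<Rightarrow> 'v set"
  assumes card_edge: "E \<in> V \<Longrightarrow> card E = d"
    and nonempty_edge: "E \<in> V \<Longrightarrow> E \<noteq> {}"
    and collage_subset: "C \<subseteq> V"
    and \<phi>_mem: "E \<in> V \<Longrightarrow> \<phi> E \<in> C"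
    and \<phi>_fixed: "F \<in> C \<Longrightarrow> \<phi> F = F"
    and \<phi>_near: "E \<in> V \<Longrightarrow> \<exists>v\<in>E. E - {v} \<subseteq> \<phi> E"
begin

lemma card_\<phi>: "E \<in> V \<Longrightarrow> card (\<phi> E) = d"
  using \<phi>_mem collage_subset card_edge by blast

text \<open>Uniformity turns nearness into an exchange: \<open>E\<close> has one vertex outside
  \<open>\<phi> E\<close>, and equal sizes force it to miss exactly one vertex of
  \<open>\<phi> E\<close>.\<close>

lemma exchange:
  assumes E: "E \<in> V" and ne: "E \<noteq> \<phi> E"
  obtains u w where "\<phi> E - E = {u}" "E - \<phi> E = {w}"
proof -
  obtain w where w: "w \<in> E" "E - {w} \<subseteq> \<phi> E"
    using \<phi>_near[OF E] by blast
  have card_eq: "card (\<phi> E) = card E"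
    using card_\<phi>[OF E] card_edge[OF E] by simp
  have "w \<notin> \<phi> E"
    using w(2) ne card_subset_eq[of "\<phi> E" E] card_eq by auto
  then have diff: "E - \<phi> E = {w}"
    using w by auto
  have "card (\<phi> E - E) = card (E - \<phi> E)"
    using card_eq by (simp add: card_Diff_subset_Int Int_commute)
  then obtain u where "\<phi> E - E = {u}"
    using diff by (auto simp: card_1_singleton_iff)
  then show ?thesis
    using diff by (rule that)
qed

definition \<Delta> :: "'v set set set" where
  "\<Delta> = {A. A \<subseteq> V \<and> (\<forall>E\<in>A. \<forall>E'\<in>A. \<phi> E = \<phi> E' \<longrightarrow> E \<noteq> \<phi> E \<longrightarrow> E' \<noteq> \<phi> E' \<longrightarrow> \<phi> E - E = \<phi> E' - E')}"

lemma \<Delta>_missing: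
  "A \<in> \<Delta> \<Longrightarrow> E \<in> A \<Longrightarrow> E' \<in> A \<Longrightarrow> \<phi> E = \<phi> E' \<Longrightarrow> E \<noteq> \<phi> E \<Longrightarrow> E' \<noteq> \<phi> E' \<Longrightarrow> \<phi> E - E = \<phi> E' - E'"
  unfolding \<Delta>_def by blast

lemma insert_apex:
  assumes E: "E \<in> V" "E \<subseteq> S" and A: "A \<in> \<Delta>" "\<Union>A \<subseteq> S"
  shows "insert (if \<phi> E \<subseteq> S then \<phi> E else E) A \<in> \<Delta>"
proof (cases "\<phi> E \<subseteq> S")
  case True
  define p where "p = \<phi> E"
  have p: "\<phi> p = p" "p \<in> V"
    using E(1) \<phi>_mem \<phi>_fixed collage_subset by (auto simp: p_def)
  have "\<phi> E1 - E1 = \<phi> E2 - E2" if "E1 \<in> insert p A" "E2 \<in> insert p A" "\<phi> E1 = \<phi> E2" "E1 \<noteq> \<phi> E1"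
      "E2 \<noteq> \<phi> E2"
    for E1 E2
  proof (rule \<Delta>_missing[OF A(1)])
    \<comment> \<open>\<open>p\<close> is fixed by \<open>\<phi>\<close>, so it takes part in no
      comparison.\<close>
    show "E1 \<in> A" "E2 \<in> A"
      using that p(1) by auto
  qed (use that in auto)
  moreover have "insert p A \<subseteq> V"
    using A(1) p(2) by (simp add: \<Delta>_def)
  ultimately have "insert p A \<in> \<Delta>"
    unfolding \<Delta>_def by blast
  then show ?thesis
    using True by (simp add: p_def)
next
  case False
  then obtain x where x: "x \<in> \<phi> E" "x \<notin> S"
    by blast
  \<comment> \<open>All edges in \<open>S\<close> that are assigned to \<open>\<phi> E\<close> miss the same vertex of it, because \<open>\<phi> E\<close> is not in \<open>S\<close>.\<close>
  have missing: "\<phi> E' - E' = {x}" if E': "E' \<in> V" "E' \<subseteq> S" "\<phi> E' = \<phi> E" "E' \<noteq> \<phi> E'" for E'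
  proof -
    obtain u w where "\<phi> E' - E' = {u}" "E' - \<phi> E' = {w}"
      by (rule exchange[OF E'(1,4)])
    moreover have "x \<in> \<phi> E' - E'"
      using x E'(2,3) by auto
    ultimately show ?thesis
      by auto
  qed
  have "\<phi> E1 - E1 = \<phi> E2 - E2" if "E1 \<in> insert E A" "E2 \<in> insert E A" "\<phi> E1 = \<phi> E2" "E1 \<noteq> \<phi> E1"
      "E2 \<noteq> \<phi> E2"
    for E1 E2
  proof (cases "\<phi> E1 = \<phi> E")
    case True
    have "E1 \<in> V" "E1 \<subseteq> S" "E2 \<in> V" "E2 \<subseteq> S"
      using that(1,2) A E by (auto simp: \<Delta>_def)
    then show ?thesis
      using missing[of E1] missing[of E2] that True by simp
  next
    case False
    then have "E1 \<in> A" "E2 \<in> A"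
      using that(1-3) by auto
    then show ?thesis
      using \<Delta>_missing[OF A(1)] that(3-5) by blast
  qed
  moreover have "insert E A \<subseteq> V"
    using A(1) E(1) by (simp add: \<Delta>_def)
  ultimately have "insert E A \<in> \<Delta>"
    unfolding \<Delta>_def by blast
  then show ?thesis
    using False by simp
qed

lemma conical_complex_\<Delta>:
  assumes "inj_on ord V"
  shows "conical_complex V ord \<Delta>"
proof
  show "\<exists>p\<in>V. p \<subseteq> S \<and> (\<forall>A\<in>\<Delta>. \<Union>A \<subseteq> S \<longrightarrow> insert p A \<in> \<Delta>)" if "E \<in> V" "E \<subseteq> S" for E S
    using that \<phi>_mem[OF that(1)] collage_subset insert_apex[OF that]
    by (intro bexI[of _ "if \<phi> E \<subseteq> S then \<phi> E else E"]) auto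
  show "B \<in> \<Delta>" if "A \<in> \<Delta>" "B \<subseteq> A" for A B
    using that unfolding \<Delta>_def by blast
qed (use assms in \<open>auto simp: \<Delta>_def\<close>)

lemma card_Union_group:
  assumes A: "A \<in> \<Delta>" and F: "F \<in> \<phi> ` A"
  shows "card (\<Union>{E \<in> A. \<phi> E = F}) \<le> card {E \<in> A. \<phi> E = F} + (d - 1)"
proof -
  let ?G = "{E \<in> A. \<phi> E = F}"
  have AV: "A \<subseteq> V"
    using A by (simp add: \<Delta>_def)
  have F': "F \<in> C" "F \<in> V"
    using F AV \<phi>_mem collage_subset by auto
  have d: "card F = d" "d \<noteq> 0"
    using card_edge[OF F'(2)] nonempty_edge[OF F'(2)] by auto
  show ?thesis
  proof (cases "?G \<subseteq> {F}")
    case True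
    moreover have "?G \<noteq> {}"
      using F by auto
    ultimately have "?G = {F}"
      by (simp only: subset_singleton_iff) blast
    then show ?thesis
      using d by simp
  next
    case False
    \<comment> \<open>One edge of the group different from \<open>F\<close> determines the vertex
      \<open>u\<close> of \<open>F\<close> that all such edges miss.\<close>
    then obtain E where E: "E \<in> A" "\<phi> E = F" "E \<noteq> F"
      by blast
    have "E \<in> V"
      using E AV by blast
    then obtain u w where "\<phi> E - E = {u}" "E - \<phi> E = {w}"
      by (rule exchange) (simp add: E(2,3))
    then have u: "F - E = {u}"
      by (simp add: E(2))
    have missing: "F - E' = {u}" if "E' \<in> ?G - {F}" for E'
    proof -
      have "E' \<in> A" "\<phi> E' = F" "E' \<noteq> F"
        using that by auto
      then show ?thesis
        using \<Delta>_missing[OF A, of E' E] E u by simp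
    qed
    have gained: "card (E' - F) = 1" if G: "E' \<in> ?G - {F}" for E'
    proof -
      have E': "E' \<in> V" "E' \<noteq> \<phi> E'" "\<phi> E' = F"
        using G AV by auto
      obtain u w where "\<phi> E' - E' = {u}" "E' - \<phi> E' = {w}"
        by (rule exchange[OF E'(1,2)])
      then show ?thesis
        using E'(3) by simp
    qed
    have "card (\<Union>E'\<in>?G - {F}. E' - F) \<le> (\<Sum>E'\<in>?G - {F}. card (E' - F))"
      by (rule card_UN_le) simp
    also have "\<dots> = card (?G - {F})"
      using gained by simp
    finally have le: "card (B \<union> (\<Union>E'\<in>?G - {F}. E' - F)) \<le> card B + card (?G - {F})" for B
      using card_Un_le[of B "\<Union>E'\<in>?G - {F}. E' - F"] by linarith
    show ?thesis
    proof (cases "F \<in> A")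
      case True
      \<comment> \<open>\<open>F\<close> counts as an edge of the group, so its d vertices cost 1 +
        (d - 1).\<close>
      then have "F \<in> ?G"
        using F'(1) \<phi>_fixed by simp
      then have "card ?G = Suc (card (?G - {F}))"
        by (intro card.remove) simp_all
      moreover have "\<Union>?G \<subseteq> F \<union> (\<Union>E'\<in>?G - {F}. E' - F)"
        by auto
      then have "card (\<Union>?G) \<le> card (F \<union> (\<Union>E'\<in>?G - {F}. E' - F))"
        by (intro card_mono) auto
      ultimately show ?thesis
        using le[of F] d by linarith
    next
      case F_out: False
      \<comment> \<open>Without \<open>F\<close>, no edge of the group covers \<open>u\<close>,
        which saves the one vertex by which the bound would fail.\<close>
      then have G: "?G - {F} = ?G"
        by auto
      have "\<Union>?G \<subseteq> (F - {u}) \<union> (\<Union>E'\<in>?G - {F}. E' - F)"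
      proof
        fix x assume "x \<in> \<Union>?G"
        then obtain E' where E': "E' \<in> ?G" "x \<in> E'"
          by (rule UnionE)
        have "E' \<in> ?G - {F}"
          using E'(1) by (simp only: G)
        then show "x \<in> (F - {u}) \<union> (\<Union>E'\<in>?G - {F}. E' - F)"
          using missing[of E'] E'(2) by (cases "x \<in> F") auto
      qed
      then have "card (\<Union>?G) \<le> card ((F - {u}) \<union> (\<Union>E'\<in>?G - {F}. E' - F))"
        by (intro card_mono) auto
      moreover have "card (F - {u}) = d - 1"
        using u d by (subst card_Diff_singleton) auto
      ultimately show ?thesis
        using le[of "F - {u}"] G by simp
    qed
  qed
qed

text \<open>The groups with a common value of \<open>\<phi>\<close> partition \<open>A\<close>.
  There is at most one per collage edge, and each covers at most \<open>d - 1\<close> more vertices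
  than it has edges.\<close>

lemma card_Union_face:
  assumes A: "A \<in> \<Delta>"
  shows "card (\<Union>A) \<le> card A + (d - 1) * card C"
proof -
  let ?G = "\<lambda>F. {E \<in> A. \<phi> E = F}"
  have "\<Union>A = (\<Union>F\<in>\<phi> ` A. \<Union>(?G F))"
    by auto
  then have "card (\<Union>A) = card (\<Union>F\<in>\<phi> ` A. \<Union>(?G F))"
    by (rule arg_cong)
  also have "\<dots> \<le> (\<Sum>F\<in>\<phi> ` A. card (\<Union>(?G F)))"
    by (rule card_UN_le) simp
  also have "\<dots> \<le> (\<Sum>F\<in>\<phi> ` A. card (?G F) + (d - 1))"
    by (intro sum_mono card_Union_group[OF A])
  also have "\<dots> = (\<Sum>F\<in>\<phi> ` A. card (?G F)) + (d - 1) * card (\<phi> ` A)"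
    by (simp add: sum.distrib)
  also have "(\<Sum>F\<in>\<phi> ` A. card (?G F)) = card A"
    using sum.image_gen[of A "\<lambda>_. 1 :: nat" \<phi>] by simp
  also have "card (\<phi> ` A) \<le> card C"
    using A \<phi>_mem by (intro card_mono) (auto simp: \<Delta>_def)
  finally show ?thesis
    by simp
qed

end

theorem theorem1p1:
  fixes \<E> :: "'v::finite set set" and d :: nat
  assumes "simple_hypergraph \<E>" and "uniform d \<E>"
  shows "reg (quotient_module (edge_ideal \<E> :: ('v, 'k::field) mpoly set))
           \<le> ereal ((real d - 1) * real (min_two_collage_size \<E>))"
proof -
  have ne: "E \<noteq> {}" if "E \<in> \<E>" for E
    using assms(1) that by (auto simp: simple_hypergraph_def hypergraph_def)
  let ?sizes = "{card \<C> | \<C>. two_collage \<E> \<C>}"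
  \<comment> \<open>All edges together form a 2-collage, so the minimum is over a nonempty set and
    is attained.\<close>
  have "two_collage \<E> \<E>"
    using ne by (auto simp: two_collage_def)
  then have "Min ?sizes \<in> ?sizes"
    by (intro Min_in) auto
  then obtain \<C> where \<C>: "two_collage \<E> \<C>" "card \<C> = min_two_collage_size \<E>"
    by (auto simp: min_two_collage_size_def)
  define near where "near E F \<longleftrightarrow> F \<in> \<C> \<and> (\<exists>v\<in>E. E - {v} \<subseteq> F)" for E F
  \<comment> \<open>Collage edges are kept fixed, so that they are exempt from the condition in
    \<open>\<Delta>\<close> and can serve as apexes.\<close>
  define \<phi> where "\<phi> E = (if E \<in> \<C> then E else SOME F. near E F)" for E
  have near: "near E (\<phi> E)" if "E \<in> \<E>" for E
  proof (cases "E \<in> \<C>")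
    case True
    then show ?thesis
      using ne[OF that] by (auto simp: \<phi>_def near_def)
  next
    case False
    have "\<exists>F. near E F"
      using \<C>(1) that unfolding near_def two_collage_def by blast
    then show ?thesis
      using False by (simp add: \<phi>_def someI_ex)
  qed
  interpret collage \<E> \<C> d \<phi>
  proof
    show "card E = d" if "E \<in> \<E>" for E
      using assms(2) that by (simp add: uniform_def)
    show "\<C> \<subseteq> \<E>"
      using \<C>(1) by (simp add: two_collage_def)
  qed (use ne near in \<open>auto simp: near_def \<phi>_def\<close>)
  \<comment> \<open>The numbering of the edges only fixes the signs.\<close>
  obtain ord :: "'v set \<Rightarrow> nat" where "inj_on ord \<E>"
    using finite_imp_inj_to_nat_seg[of \<E>] by auto
  then interpret conical_complex \<E> ord \<Delta>
    by (rule conical_complex_\<Delta>)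
  \<comment> \<open>The truncated \<open>d - 1\<close> agrees with the real one as soon as there is
    an edge; for an empty collage both products are 0.\<close>
  have d: "real (d - 1) * real (card \<C>) = (real d - 1) * real (card \<C>)"
  proof (cases "\<C> = {}")
    case False
    then obtain F where "F \<in> \<E>"
      using collage_subset by blast
    then have "d \<noteq> 0"
      using card_edge[of F] nonempty_edge[of F] by auto
    then show ?thesis
      by (simp add: of_nat_diff)
  qed simp
  show ?thesis
  proof (rule reg_edge_ideal_le)
    fix A assume "A \<in> \<Delta>"
    from card_Union_face[OF this] have "real (card (\<Union>A)) \<le> real (card A + (d - 1) * card \<C>)"
      by (simp only: of_nat_le_iff)
    then show "real (card (\<Union>A)) \<le> real (card A) + (real d - 1) * real (min_two_collage_size \<E>)"
      by (simp only: of_nat_add of_nat_mult d flip: \<C>(2))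
  qed
qed

end
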